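(* For $s\in\mathbb{R}$ let $\pi_s$ be the unitary representation of Thompson's group $F$ on $L^2([0,1])$ given by $\pi_s(\gamma) f = \left(\frac{d\gamma_*\mu}{d\mu}\right)^{1/2+is} \, f\circ\gamma^{-1}$, where $\mu$ is the Lebesgue measure on $[0,1]$. For $s,t\in\mathbb{R}$, the representations $\pi_s$ and $\pi_t$ are unitarily equivalent if and only if $s-t=2k\pi/\log 2$ for some $k\in\mathbb{Z}$.
   Context: Thompson's group $F$ consists of all orientation-preserving piecewise linear homeomorphisms $\phi$ of the unit interval $[0,1]$ such that (1) $\phi$ preserves the set $\mathbb{Z}[1/2]\cap[0,1]$ of dyadic rationals in $[0,1]$; (2) $\phi$ has finitely many nondifferentiability points, all lying in $\mathbb{Z}[1/2]$; (3) the slopes of $\phi$ are of the form $2^k$, $k\in\mathbb{Z}$. $F$ is regarded as a discrete group. $\mu$ is the Lebesgue measure on $[0,1]$, which is quasi-invariant under $F$; $\gamma_*\mu$ is the pushforward of $\mu$ and $d\gamma_*\mu/d\mu$ its Radon–Nikodym derivative (an almost everywhere positive function). $L^2([0,1])$ is the complex Hilbert space with respect to $\mu$, and $\log$ is the natural logarithm. *)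

theory Defs
  imports "HOL-Analysis.Analysis"
begin

section \<open>Thompson's group\<close>

definition dyadic_rationals :: "real set"
  where "dyadic_rationals = {of_int m / 2 ^ n | (m :: int) (n :: nat). True}"

definition piecewise_linear_on :: "real set \<Rightarrow> (real \<Rightarrow> real) \<Rightarrow> bool"
  where "piecewise_linear_on I f \<longleftrightarrow>
    (\<exists>B. finite B \<and>
      (\<forall>a b. a < b \<longrightarrow> {a..b} \<subseteq> I \<longrightarrow> {a<..<b} \<inter> B = {} \<longrightarrow>
        (\<exists>m c. \<forall>x\<in>{a..b}. f x = m * x + c)))"

definition nondiff_points :: "(real \<Rightarrow> real) \<Rightarrow> real set"
  where "nondiff_points \<phi> = {x \<in> {0..1}. \<not> \<phi> differentiable (at x within {0..1})}"

text \<open>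
  A self-map of the unit interval is represented by its extension to the real line by the
  identity. The representation is unique, and composition, \<^const>\<open>id\<close> and \<^const>\<open>inv\<close> on the
  real line are the group operations.
\<close>

definition thompson_F :: "(real \<Rightarrow> real) set"
  where "thompson_F = {\<phi>.
    (\<forall>x. x \<notin> {0..1} \<longrightarrow> \<phi> x = x) \<and>
    (\<exists>\<psi>. homeomorphism {0..1} {0..1} \<phi> \<psi>) \<and>
    strict_mono_on {0..1} \<phi> \<and>
    piecewise_linear_on {0..1} \<phi> \<and>
    \<phi> ` (dyadic_rationals \<inter> {0..1}) = dyadic_rationals \<inter> {0..1} \<and>
    finite (nondiff_points \<phi>) \<and> nondiff_points \<phi> \<subseteq> dyadic_rationals \<and>
    (\<forall>x\<in>{0..1}. \<forall>d. (\<phi> has_real_derivative d) (at x within {0..1}) \<longrightarrow>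
      (\<exists>k::int. d = 2 powi k))}"


section \<open>The complex Hilbert space of square-integrable functions on the unit interval\<close>

text \<open>
  Lebesgue measure on the Borel sets of the unit interval. Completing the sigma-algebra
  would not change the almost-everywhere classes.
\<close>

definition unit_lebesgue :: "real measure"
  where "unit_lebesgue = restrict_space lborel {0..1}"

definition sq_integrable :: "(real \<Rightarrow> complex) \<Rightarrow> bool"
  where "sq_integrable f \<longleftrightarrow>
    f \<in> borel_measurable unit_lebesgue \<and> integrable unit_lebesgue (\<lambda>x. (cmod (f x))\<^sup>2)"

definition l2_rel :: "(real \<Rightarrow> complex) \<Rightarrow> (real \<Rightarrow> complex) \<Rightarrow> bool"
  where "l2_rel f g \<longleftrightarrow>
    sq_integrable f \<and> sq_integrable g \<and> (AE x in unit_lebesgue. f x = g x)"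

lemma sq_integrable_zero: "sq_integrable (\<lambda>_. 0)"
  by (simp add: sq_integrable_def)

lemma sq_integrable_scale:
  assumes "sq_integrable f" shows "sq_integrable (\<lambda>x. c * f x)"
  using assms by (auto simp: sq_integrable_def norm_mult power_mult_distrib)

lemma sq_integrable_add:
  assumes "sq_integrable f" "sq_integrable g" shows "sq_integrable (\<lambda>x. f x + g x)"
proof -
  have [measurable]: "f \<in> borel_measurable unit_lebesgue" "g \<in> borel_measurable unit_lebesgue"
    using assms by (auto simp: sq_integrable_def)
  have le: "(cmod (f x + g x))\<^sup>2 \<le> 2 * (cmod (f x))\<^sup>2 + 2 * (cmod (g x))\<^sup>2" for x
  proof -
    have "(cmod (f x + g x))\<^sup>2 \<le> (cmod (f x) + cmod (g x))\<^sup>2"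
      by (intro power_mono norm_triangle_ineq) auto
    also have "\<dots> \<le> 2 * (cmod (f x))\<^sup>2 + 2 * (cmod (g x))\<^sup>2"
      using sum_squares_bound[of "cmod (f x)" "cmod (g x)"] by (simp add: power2_sum)
    finally show ?thesis .
  qed
  have "integrable unit_lebesgue (\<lambda>x. 2 * (cmod (f x))\<^sup>2 + 2 * (cmod (g x))\<^sup>2)"
    using assms by (auto simp: sq_integrable_def)
  then have "integrable unit_lebesgue (\<lambda>x. (cmod (f x + g x))\<^sup>2)"
    by (rule Bochner_Integration.integrable_bound) (use le in auto)
  then show ?thesis by (simp add: sq_integrable_def)
qed

lemma sq_integrable_uminus: "sq_integrable f \<Longrightarrow> sq_integrable (\<lambda>x. - f x)"
  using sq_integrable_scale[of f "-1"] by simp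

lemma sq_integrable_diff:
  "sq_integrable f \<Longrightarrow> sq_integrable g \<Longrightarrow> sq_integrable (\<lambda>x. f x - g x)"
  using sq_integrable_add[of f "\<lambda>x. - g x"] sq_integrable_uminus[of g] by simp

lemma part_equivp_l2_rel: "part_equivp l2_rel"
proof (rule part_equivpI)
  show "\<exists>f. l2_rel f f" using sq_integrable_zero by (auto simp: l2_rel_def)
  show "symp l2_rel" by (auto simp: symp_def l2_rel_def)
  show "transp l2_rel" by (force simp: transp_def l2_rel_def)
qed

quotient_type l2 = "real \<Rightarrow> complex" / partial: l2_rel
  by (rule part_equivp_l2_rel)

instantiation l2 :: ab_group_add
begin

lift_definition zero_l2 :: l2 is "\<lambda>_. 0"
  by (simp add: l2_rel_def sq_integrable_zero)

lift_definition plus_l2 :: "l2 \<Rightarrow> l2 \<Rightarrow> l2" is "\<lambda>f g x. f x + g x"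
  by (auto simp: l2_rel_def sq_integrable_add)

lift_definition uminus_l2 :: "l2 \<Rightarrow> l2" is "\<lambda>f x. - f x"
  by (auto simp: l2_rel_def sq_integrable_uminus)

lift_definition minus_l2 :: "l2 \<Rightarrow> l2 \<Rightarrow> l2" is "\<lambda>f g x. f x - g x"
  by (auto simp: l2_rel_def sq_integrable_diff)

instance
  by standard
    (transfer; auto simp: l2_rel_def sq_integrable_add sq_integrable_zero
      sq_integrable_uminus sq_integrable_diff algebra_simps)+

end

lift_definition scale_l2 :: "complex \<Rightarrow> l2 \<Rightarrow> l2" is "\<lambda>c f x. c * f x"
  by (auto simp: l2_rel_def sq_integrable_scale)

lemma vector_space_scale_l2: "vector_space scale_l2"
  by standard
    (transfer; auto simp: l2_rel_def sq_integrable_add sq_integrable_scale algebra_simps)+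

lemma borel_measurable_cnj:
  "f \<in> borel_measurable M \<Longrightarrow> (\<lambda>x. cnj (f x)) \<in> borel_measurable M"
  by (rule borel_measurable_continuous_on[where f = cnj]) (auto intro: continuous_intros)

lift_definition inner_l2 :: "l2 \<Rightarrow> l2 \<Rightarrow> complex"
  is "\<lambda>f g. \<integral>x. f x * cnj (g x) \<partial>unit_lebesgue"
  by (rule integral_cong_AE) (auto simp: l2_rel_def sq_integrable_def
      intro!: borel_measurable_times borel_measurable_cnj)

lemma l2_cases: obtains f where "sq_integrable f" "\<xi> = abs_l2 f"
proof -
  have "l2_rel (rep_l2 \<xi>) (rep_l2 \<xi>)"
    using Quotient_rep_reflp[OF Quotient_l2] .
  then show ?thesis
    using that Quotient_abs_rep[OF Quotient_l2] by (metis l2_rel_def)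
qed

lemma abs_l2_eq:
  assumes "sq_integrable f" "sq_integrable g" "AE x in unit_lebesgue. f x = g x"
  shows "abs_l2 f = abs_l2 g"
  using assms by (intro Quotient_rel_abs[OF Quotient_l2]) (simp add: l2_rel_def)

lemma l2_rel_rep_abs: "sq_integrable f \<Longrightarrow> l2_rel (rep_l2 (abs_l2 f)) f"
  by (intro Quotient_rep_abs[OF Quotient_l2]) (simp add: l2_rel_def)

definition unitary_l2 :: "(l2 \<Rightarrow> l2) \<Rightarrow> bool"
  where "unitary_l2 U \<longleftrightarrow>
    Vector_Spaces.linear scale_l2 scale_l2 U \<and> surj U \<and>
    (\<forall>\<xi> \<eta>. inner_l2 (U \<xi>) (U \<eta>) = inner_l2 \<xi> \<eta>)"

definition unitarily_equivalent_on :: "'g set \<Rightarrow> ('g \<Rightarrow> l2 \<Rightarrow> l2) \<Rightarrow> ('g \<Rightarrow> l2 \<Rightarrow> l2) \<Rightarrow> bool"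
  where "unitarily_equivalent_on G \<pi> \<sigma> \<longleftrightarrow>
    (\<exists>U. unitary_l2 U \<and> (\<forall>g\<in>G. U \<circ> \<pi> g = \<sigma> g \<circ> U))"


section \<open>The representations\<close>

definition pushforward_deriv :: "(real \<Rightarrow> real) \<Rightarrow> real \<Rightarrow> real"
  where "pushforward_deriv \<gamma> x =
    enn2real (RN_deriv unit_lebesgue (distr unit_lebesgue unit_lebesgue \<gamma>) x)"

definition koopman_fun :: "real \<Rightarrow> (real \<Rightarrow> real) \<Rightarrow> (real \<Rightarrow> complex) \<Rightarrow> real \<Rightarrow> complex"
  where "koopman_fun s \<gamma> f x =
    complex_of_real (pushforward_deriv \<gamma> x) powr Complex (1/2) s * f (inv \<gamma> x)"

text \<open>
  The operator is independent of the representative (\<open>koopman_rep_abs_l2\<close> together with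
  \<open>thompson_F_nonsingular\<close>), and it defines a unitary representation
  (\<open>unitary_koopman_rep\<close>, \<open>koopman_rep_comp\<close>, \<open>koopman_rep_id\<close>).
\<close>

definition koopman_rep :: "real \<Rightarrow> (real \<Rightarrow> real) \<Rightarrow> l2 \<Rightarrow> l2"
  where "koopman_rep s \<gamma> \<xi> = abs_l2 (koopman_fun s \<gamma> (rep_l2 \<xi>))"


section \<open>Well-definedness and unitarity\<close>

definition nonsingular :: "(real \<Rightarrow> real) \<Rightarrow> bool"
  where "nonsingular \<gamma> \<longleftrightarrow> bij \<gamma> \<and>
    \<gamma> \<in> unit_lebesgue \<rightarrow>\<^sub>M unit_lebesgue \<and> inv \<gamma> \<in> unit_lebesgue \<rightarrow>\<^sub>M unit_lebesgue \<and>
    absolutely_continuous unit_lebesgue (distr unit_lebesgue unit_lebesgue \<gamma>) \<and>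
    absolutely_continuous unit_lebesgue (distr unit_lebesgue unit_lebesgue (inv \<gamma>))"

lemma nonsingular_inv: "nonsingular \<gamma> \<Longrightarrow> nonsingular (inv \<gamma>)"
  by (simp add: nonsingular_def bij_imp_bij_inv inv_inv_eq)

lemma space_unit_lebesgue: "space unit_lebesgue = {0..1}"
  by (simp add: unit_lebesgue_def space_restrict_space)

lemma null_sets_unit_lebesgue:
  "N \<in> null_sets unit_lebesgue \<longleftrightarrow> N \<subseteq> {0..1} \<and> N \<in> sets borel \<and> negligible N"
  by (auto simp: unit_lebesgue_def null_sets_restrict_space negligible_iff_null_sets
      null_sets_completion_iff null_sets_def sets_restrict_space emeasure_restrict_space)

lemma sets_unit_lebesgue: "A \<in> sets unit_lebesgue \<longleftrightarrow> A \<subseteq> {0..1} \<and> A \<in> sets borel"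
  by (auto simp: unit_lebesgue_def sets_restrict_space_iff)

lemma measurable_unit_lebesgueI:
  assumes "continuous_on {0..1} f" "f ` {0..1} \<subseteq> {0..1}"
  shows "f \<in> unit_lebesgue \<rightarrow>\<^sub>M unit_lebesgue"
  unfolding unit_lebesgue_def
proof (rule measurable_restrict_space2)
  show "f \<in> restrict_space lborel {0..1} \<rightarrow>\<^sub>M lborel"
    using borel_measurable_continuous_on_restrict[OF assms(1)]
    by (simp add: measurable_def space_restrict_space sets_restrict_space)
  show "f \<in> space (restrict_space lborel {0..1}) \<rightarrow> {0..1}"
    using assms(2) by (auto simp: space_restrict_space)
qed

lemma thompson_F_nonsingular:
  assumes "\<gamma> \<in> thompson_F" shows "nonsingular \<gamma>"
proof -
  obtain \<psi> where hom: "homeomorphism {0..1} {0..1} \<gamma> \<psi>"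
    using assms by (auto simp: thompson_F_def)
  have out: "\<gamma> x = x" if "x \<notin> {0..1}" for x
    using assms that unfolding thompson_F_def by blast
  have maps: "\<gamma> ` {0..1} = {0..1}" using hom by (simp add: homeomorphism_def)
  have bij: "bij \<gamma>"
  proof (rule bijI)
    have "inj_on \<gamma> {0..1}" using hom by (metis homeomorphism_def inj_on_inverseI)
    then show "inj \<gamma>" unfolding inj_def inj_on_def using out maps by (metis imageI)
    show "surj \<gamma>" unfolding surj_def using out maps by (metis imageE)
  qed
  have inv: "inv \<gamma> y = \<psi> y" if "y \<in> {0..1}" for y
    using hom that bij by (intro inv_f_eq bij_is_inj) (auto simp: homeomorphism_def)
  have m1: "\<gamma> \<in> unit_lebesgue \<rightarrow>\<^sub>M unit_lebesgue"
    using hom by (intro measurable_unit_lebesgueI) (auto simp: homeomorphism_def)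
  have "continuous_on {0..1} (inv \<gamma>)"
    using hom inv continuous_on_cong[of "{0..1}" "{0..1}" "inv \<gamma>" \<psi>]
    by (simp add: homeomorphism_def)
  moreover have invmaps: "inv \<gamma> ` {0..1} = {0..1}"
    using hom inv image_cong[of "{0..1}" "{0..1}" "inv \<gamma>" \<psi>] by (simp add: homeomorphism_def)
  ultimately have m2: "inv \<gamma> \<in> unit_lebesgue \<rightarrow>\<^sub>M unit_lebesgue"
    by (intro measurable_unit_lebesgueI) auto
  have fin: "finite (nondiff_points \<gamma>)"
    and slope: "\<And>x d. x \<in> {0..1} \<Longrightarrow> (\<gamma> has_real_derivative d) (at x within {0..1})
      \<Longrightarrow> \<exists>k::int. d = 2 powi k"
    using assms by (auto simp: thompson_F_def)
  let ?E = "nondiff_points \<gamma>"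
  have neg_image: "negligible (\<gamma> ` N)" if N: "negligible N" "N \<subseteq> {0..1}" for N
  proof -
    have "\<gamma> differentiable_on (N - ?E)"
      unfolding differentiable_on_def
    proof
      fix x assume "x \<in> N - ?E"
      then have "\<gamma> differentiable (at x within {0..1})" using N by (auto simp: nondiff_points_def)
      then show "\<gamma> differentiable (at x within N - ?E)"
        by (rule differentiable_within_subset) (use N in auto)
    qed
    then have "negligible (\<gamma> ` (N - ?E))"
      using N by (intro negligible_differentiable_image_negligible) (auto intro: negligible_diff)
    then have "negligible (\<gamma> ` (N - ?E) \<union> \<gamma> ` ?E)"
      using fin by (intro negligible_Un) (auto intro: negligible_finite)
    then show ?thesis by (rule negligible_subset) auto
  qed
  have neg_inv: "negligible (inv \<gamma> ` N)" if N: "negligible N" "N \<subseteq> {0..1}" for N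
  proof -
    have "inv \<gamma> differentiable_on (N - \<gamma> ` ?E)"
      unfolding differentiable_on_def
    proof
      fix y assume y: "y \<in> N - \<gamma> ` ?E"
      define x where "x = inv \<gamma> y"
      have yx: "y = \<gamma> x" using bij by (simp add: x_def bij_is_surj surj_f_inv_f)
      have x: "x \<in> {0..1}" using y N invmaps x_def by blast
      then have "\<gamma> differentiable (at x within {0..1})" using y yx by (auto simp: nondiff_points_def)
      then obtain d where d: "(\<gamma> has_real_derivative d) (at x within {0..1})"
        by (auto simp: real_differentiable_def)
      with slope x have "d \<noteq> 0" by fastforce
      have "(inv \<gamma> has_derivative (*) (inverse d)) (at (\<gamma> x) within \<gamma> ` {0..1})"
      proof (rule has_derivative_inverse_within)
        show "(\<gamma> has_derivative (*) d) (at x within {0..1})"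
          using d by (simp add: has_field_derivative_def)
        show "continuous (at (\<gamma> x) within \<gamma> ` {0..1}) (inv \<gamma>)"
          using \<open>continuous_on {0..1} (inv \<gamma>)\<close> maps x by (auto simp: continuous_on_eq_continuous_within)
        show "(*) (inverse d) \<circ> (*) d = id" using \<open>d \<noteq> 0\<close> by (auto simp: fun_eq_iff)
      qed (use x bij in \<open>auto simp: bij_is_inj bounded_linear_mult_right\<close>)
      then have "inv \<gamma> differentiable (at y within {0..1})"
        unfolding differentiable_def using yx maps by auto
      then show "inv \<gamma> differentiable (at y within N - \<gamma> ` ?E)"
        by (rule differentiable_within_subset) (use N in auto)
    qed
    then have "negligible (inv \<gamma> ` (N - \<gamma> ` ?E))"
      using N by (intro negligible_differentiable_image_negligible) (auto intro: negligible_diff)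
    then have "negligible (inv \<gamma> ` (N - \<gamma> ` ?E) \<union> inv \<gamma> ` \<gamma> ` ?E)"
      using fin by (intro negligible_Un) (auto intro: negligible_finite)
    then show ?thesis by (rule negligible_subset) auto
  qed
  have "absolutely_continuous unit_lebesgue (distr unit_lebesgue unit_lebesgue \<gamma>)"
    unfolding absolutely_continuous_def
  proof
    fix N assume N: "N \<in> null_sets unit_lebesgue"
    have "\<gamma> -` N \<inter> {0..1} = inv \<gamma> ` N"
      using bij_vimage_eq_inv_image[OF bij, of N] N invmaps
      by (auto simp: null_sets_unit_lebesgue)
    then have "\<gamma> -` N \<inter> space unit_lebesgue \<in> null_sets unit_lebesgue"
      using neg_inv N measurable_sets[OF m1, of N]
      by (auto simp: space_unit_lebesgue null_sets_unit_lebesgue sets_unit_lebesgue)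
    then show "N \<in> null_sets (distr unit_lebesgue unit_lebesgue \<gamma>)"
      using N m1 by (simp add: null_sets_distr_iff null_setsD2)
  qed
  moreover have "absolutely_continuous unit_lebesgue (distr unit_lebesgue unit_lebesgue (inv \<gamma>))"
    unfolding absolutely_continuous_def
  proof
    fix N assume N: "N \<in> null_sets unit_lebesgue"
    have "inv \<gamma> -` N \<inter> {0..1} = \<gamma> ` N"
      using bij_vimage_eq_inv_image[OF bij_imp_bij_inv[OF bij], of N] N maps
      by (auto simp: null_sets_unit_lebesgue inv_inv_eq[OF bij])
    then have "inv \<gamma> -` N \<inter> space unit_lebesgue \<in> null_sets unit_lebesgue"
      using neg_image N measurable_sets[OF m2, of N]
      by (auto simp: space_unit_lebesgue null_sets_unit_lebesgue sets_unit_lebesgue)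
    then show "N \<in> null_sets (distr unit_lebesgue unit_lebesgue (inv \<gamma>))"
      using N m2 by (simp add: null_sets_distr_iff null_setsD2)
  qed
  ultimately show ?thesis using bij m1 m2 by (simp add: nonsingular_def)
qed

lemma sigma_finite_unit_lebesgue: "sigma_finite_measure unit_lebesgue"
  unfolding unit_lebesgue_def
  by (rule sigma_finite_measure_restrict_space) (auto intro: sigma_finite_lborel)

lemma borel_measurable_pushforward_deriv [measurable]:
  "pushforward_deriv \<gamma> \<in> borel_measurable unit_lebesgue"
  unfolding pushforward_deriv_def by measurable

lemma pushforward_deriv_nonneg: "pushforward_deriv \<gamma> x \<ge> 0"
  by (simp add: pushforward_deriv_def)

lemma finite_unit_lebesgue: "finite_measure unit_lebesgue"
  by (rule finite_measureI) (simp add: unit_lebesgue_def emeasure_restrict_space space_restrict_space)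

lemma density_pushforward_deriv:
  assumes "nonsingular \<gamma>"
  shows "density unit_lebesgue (\<lambda>x. ennreal (pushforward_deriv \<gamma> x)) =
    distr unit_lebesgue unit_lebesgue \<gamma>"
proof -
  interpret sigma_finite_measure unit_lebesgue by (rule sigma_finite_unit_lebesgue)
  let ?N = "distr unit_lebesgue unit_lebesgue \<gamma>"
  have ac: "absolutely_continuous unit_lebesgue ?N" "\<gamma> \<in> unit_lebesgue \<rightarrow>\<^sub>M unit_lebesgue"
    using assms by (auto simp: nonsingular_def)
  interpret N: finite_measure ?N
    using ac finite_unit_lebesgue finite_measure.finite_measure_distr by blast
  have "AE x in unit_lebesgue. RN_deriv unit_lebesgue ?N x \<noteq> \<infinity>"
    by (rule RN_deriv_finite) (use ac N.sigma_finite_measure_axioms in auto)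
  then have "density unit_lebesgue (\<lambda>x. ennreal (pushforward_deriv \<gamma> x)) =
      density unit_lebesgue (RN_deriv unit_lebesgue ?N)"
    by (intro density_cong) (auto simp: pushforward_deriv_def less_top elim!: eventually_mono)
  also have "\<dots> = ?N" by (rule density_RN_deriv) (use ac in auto)
  finally show ?thesis .
qed

lemma pushforward_deriv_unique:
  assumes [measurable]: "h \<in> borel_measurable unit_lebesgue" and "\<And>x. h x \<ge> 0"
    and "density unit_lebesgue (\<lambda>x. ennreal (h x)) = distr unit_lebesgue unit_lebesgue \<gamma>"
  shows "AE x in unit_lebesgue. pushforward_deriv \<gamma> x = h x"
proof -
  interpret sigma_finite_measure unit_lebesgue by (rule sigma_finite_unit_lebesgue)
  have "AE x in unit_lebesgue. ennreal (h x) =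
      RN_deriv unit_lebesgue (distr unit_lebesgue unit_lebesgue \<gamma>) x"
    by (rule RN_deriv_unique) (use assms in auto)
  then show ?thesis
  proof eventually_elim
    case (elim x) then show ?case
      unfolding pushforward_deriv_def elim[symmetric] using assms(2) by simp
  qed
qed

lemma cmod_pushforward_powr:
  "(cmod (complex_of_real (pushforward_deriv \<gamma> x) powr Complex (1/2) s))\<^sup>2 = pushforward_deriv \<gamma> x"
proof (cases "pushforward_deriv \<gamma> x = 0")
  case False
  then show ?thesis
    using pushforward_deriv_nonneg[of \<gamma> x]
    by (simp add: norm_powr_real_powr powr_half_sqrt)
qed simp

lemma integrable_pushforward:
  fixes h :: "real \<Rightarrow> 'b::{banach, second_countable_topology}"
  assumes ns: "nonsingular \<gamma>" and [measurable]: "h \<in> borel_measurable unit_lebesgue"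
  shows "integrable unit_lebesgue (\<lambda>x. pushforward_deriv \<gamma> x *\<^sub>R h (inv \<gamma> x)) \<longleftrightarrow>
      integrable unit_lebesgue h" (is ?int)
    and "(\<integral>x. pushforward_deriv \<gamma> x *\<^sub>R h (inv \<gamma> x) \<partial>unit_lebesgue) = (\<integral>x. h x \<partial>unit_lebesgue)"
      (is ?eq)
proof -
  have [measurable]: "\<gamma> \<in> unit_lebesgue \<rightarrow>\<^sub>M unit_lebesgue" "inv \<gamma> \<in> unit_lebesgue \<rightarrow>\<^sub>M unit_lebesgue"
    and bij: "bij \<gamma>" using ns by (auto simp: nonsingular_def)
  have [simp]: "inv \<gamma> (\<gamma> x) = x" for x using bij by (simp add: bij_is_inj)
  have "integrable unit_lebesgue (\<lambda>x. pushforward_deriv \<gamma> x *\<^sub>R h (inv \<gamma> x)) \<longleftrightarrow>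
      integrable (distr unit_lebesgue unit_lebesgue \<gamma>) (\<lambda>x. h (inv \<gamma> x))"
    unfolding density_pushforward_deriv[OF ns, symmetric]
    by (subst integrable_density) (auto simp: pushforward_deriv_nonneg)
  then show ?int by (simp add: integrable_distr_eq)
  have "(\<integral>x. pushforward_deriv \<gamma> x *\<^sub>R h (inv \<gamma> x) \<partial>unit_lebesgue) =
      (\<integral>x. h (inv \<gamma> x) \<partial>distr unit_lebesgue unit_lebesgue \<gamma>)"
    unfolding density_pushforward_deriv[OF ns, symmetric]
    by (subst integral_density) (auto simp: pushforward_deriv_nonneg)
  then show ?eq by (simp add: integral_distr)
qed

lemma measurable_pushforward_powr [measurable]:
  "(\<lambda>x. complex_of_real (pushforward_deriv \<gamma> x) powr z) \<in> borel_measurable unit_lebesgue"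
proof -
  have "complex_of_real (pushforward_deriv \<gamma> x) powr z =
      (if pushforward_deriv \<gamma> x = 0 then 0 else exp (z * of_real (ln (pushforward_deriv \<gamma> x))))" for x
    using pushforward_deriv_nonneg[of \<gamma> x] by (auto simp: powr_def Ln_of_real)
  moreover have "(\<lambda>x. exp (z * complex_of_real (ln (pushforward_deriv \<gamma> x)))) \<in> borel_measurable unit_lebesgue"
    by (rule borel_measurable_continuous_on[where f = exp]) (auto intro: continuous_intros)
  ultimately show ?thesis by simp
qed

lemma measurable_koopman_fun:
  assumes "nonsingular \<gamma>" "f \<in> borel_measurable unit_lebesgue"
  shows "koopman_fun s \<gamma> f \<in> borel_measurable unit_lebesgue"
proof -
  have [measurable]: "inv \<gamma> \<in> unit_lebesgue \<rightarrow>\<^sub>M unit_lebesgue" "f \<in> borel_measurable unit_lebesgue"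
    using assms by (auto simp: nonsingular_def)
  have [measurable]: "(\<lambda>x. f (inv \<gamma> x)) \<in> borel_measurable unit_lebesgue"
    by measurable
  show ?thesis unfolding koopman_fun_def by measurable
qed

lemma sq_integrable_koopman_fun:
  assumes "nonsingular \<gamma>" "sq_integrable f"
  shows "sq_integrable (koopman_fun s \<gamma> f)"
proof -
  have "integrable unit_lebesgue (\<lambda>x. pushforward_deriv \<gamma> x *\<^sub>R (cmod (f (inv \<gamma> x)))\<^sup>2)"
    using assms by (subst integrable_pushforward) (auto simp: sq_integrable_def)
  then show ?thesis
    using assms measurable_koopman_fun[OF assms(1)]
    by (simp add: sq_integrable_def koopman_fun_def norm_mult power_mult_distrib
        cmod_pushforward_powr)
qed

lemma AE_pushforward:
  assumes ns: "nonsingular \<gamma>" and P: "AE x in unit_lebesgue. P x"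
  shows "AE x in unit_lebesgue. pushforward_deriv \<gamma> x \<noteq> 0 \<longrightarrow> P (inv \<gamma> x)"
proof -
  have [measurable]: "inv \<gamma> \<in> unit_lebesgue \<rightarrow>\<^sub>M unit_lebesgue"
    and ac: "absolutely_continuous unit_lebesgue (distr unit_lebesgue unit_lebesgue (inv \<gamma>))"
    using ns by (auto simp: nonsingular_def)
  have "AE x in distr unit_lebesgue unit_lebesgue (inv \<gamma>). P x"
    using absolutely_continuous_AE[OF _ ac P] by simp
  then have "AE x in unit_lebesgue. P (inv \<gamma> x)"
    by (rule AE_distrD[rotated]) measurable
  then show ?thesis by eventually_elim simp
qed

lemma koopman_rep_abs_l2:
  assumes ns: "nonsingular \<gamma>" and f: "sq_integrable f"
  shows "koopman_rep s \<gamma> (abs_l2 f) = abs_l2 (koopman_fun s \<gamma> f)"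
proof -
  have r: "sq_integrable (rep_l2 (abs_l2 f))" "AE x in unit_lebesgue. rep_l2 (abs_l2 f) x = f x"
    using l2_rel_rep_abs[OF f] by (auto simp: l2_rel_def)
  have "AE x in unit_lebesgue. koopman_fun s \<gamma> (rep_l2 (abs_l2 f)) x = koopman_fun s \<gamma> f x"
    using AE_pushforward[OF ns r(2)] by eventually_elim (auto simp: koopman_fun_def)
  then show ?thesis
    unfolding koopman_rep_def
    by (intro abs_l2_eq sq_integrable_koopman_fun ns f r)
qed


lemma plus_abs_l2:
  "sq_integrable f \<Longrightarrow> sq_integrable g \<Longrightarrow> abs_l2 f + abs_l2 g = abs_l2 (\<lambda>x. f x + g x)"
  by (rule plus_l2.abs_eq) (auto simp: eq_onp_def l2_rel_def)

lemma scale_abs_l2: "sq_integrable f \<Longrightarrow> scale_l2 c (abs_l2 f) = abs_l2 (\<lambda>x. c * f x)"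
  by (rule scale_l2.abs_eq) (auto simp: eq_onp_def l2_rel_def)

lemma inner_abs_l2:
  "sq_integrable f \<Longrightarrow> sq_integrable g \<Longrightarrow>
    inner_l2 (abs_l2 f) (abs_l2 g) = (\<integral>x. f x * cnj (g x) \<partial>unit_lebesgue)"
  by (rule inner_l2.abs_eq) (auto simp: eq_onp_def l2_rel_def)

lemma linear_koopman_rep:
  assumes ns: "nonsingular \<gamma>"
  shows "Vector_Spaces.linear scale_l2 scale_l2 (koopman_rep s \<gamma>)"
proof -
  interpret V: vector_space scale_l2 by (rule vector_space_scale_l2)
  show ?thesis
  proof (unfold_locales)
    fix \<xi> \<eta> :: l2 and c
    obtain f where f: "sq_integrable f" "\<xi> = abs_l2 f" by (rule l2_cases)
    obtain g where g: "sq_integrable g" "\<eta> = abs_l2 g" by (rule l2_cases)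
    have "koopman_fun s \<gamma> (\<lambda>x. f x + g x) = (\<lambda>x. koopman_fun s \<gamma> f x + koopman_fun s \<gamma> g x)"
      by (simp add: koopman_fun_def fun_eq_iff algebra_simps)
    then show "koopman_rep s \<gamma> (\<xi> + \<eta>) = koopman_rep s \<gamma> \<xi> + koopman_rep s \<gamma> \<eta>"
      using ns f g
      by (simp add: plus_abs_l2 koopman_rep_abs_l2 sq_integrable_add sq_integrable_koopman_fun)
    have "koopman_fun s \<gamma> (\<lambda>x. c * f x) = (\<lambda>x. c * koopman_fun s \<gamma> f x)"
      by (simp add: koopman_fun_def fun_eq_iff algebra_simps)
    then show "koopman_rep s \<gamma> (scale_l2 c \<xi>) = scale_l2 c (koopman_rep s \<gamma> \<xi>)"
      using ns f
      by (simp add: scale_abs_l2 koopman_rep_abs_l2 sq_integrable_scale sq_integrable_koopman_fun)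
  qed
qed

lemma inner_koopman_rep:
  assumes ns: "nonsingular \<gamma>"
  shows "inner_l2 (koopman_rep s \<gamma> \<xi>) (koopman_rep s \<gamma> \<eta>) = inner_l2 \<xi> \<eta>"
proof -
  obtain f where f: "sq_integrable f" "\<xi> = abs_l2 f" by (rule l2_cases)
  obtain g where g: "sq_integrable g" "\<eta> = abs_l2 g" by (rule l2_cases)
  have m: "(\<lambda>x. f x * cnj (g x)) \<in> borel_measurable unit_lebesgue"
    using f g by (auto simp: sq_integrable_def intro!: borel_measurable_times borel_measurable_cnj)
  have w: "p powr Complex (1/2) s * cnj (p powr Complex (1/2) s) = complex_of_real (pushforward_deriv \<gamma> x)"
    if "p = complex_of_real (pushforward_deriv \<gamma> x)" for x p
    using cmod_pushforward_powr[of \<gamma> x s] that by (metis complex_norm_square)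
  have e: "koopman_fun s \<gamma> f x * cnj (koopman_fun s \<gamma> g x) =
      pushforward_deriv \<gamma> x *\<^sub>R (f (inv \<gamma> x) * cnj (g (inv \<gamma> x)))" for x
    unfolding koopman_fun_def complex_cnj_mult scaleR_conv_of_real
    by (subst w[OF refl, of x, symmetric]) (simp only: mult_ac)
  show ?thesis
    using integrable_pushforward(2)[OF ns m] f g ns
    by (simp add: koopman_rep_abs_l2 inner_abs_l2 sq_integrable_koopman_fun e)
qed

lemma pushforward_deriv_comp:
  assumes \<gamma>: "nonsingular \<gamma>" and \<delta>: "nonsingular \<delta>"
  shows "AE x in unit_lebesgue.
    pushforward_deriv (\<gamma> \<circ> \<delta>) x = pushforward_deriv \<gamma> x * pushforward_deriv \<delta> (inv \<gamma> x)"
proof (rule pushforward_deriv_unique)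
  have [measurable]: "\<gamma> \<in> unit_lebesgue \<rightarrow>\<^sub>M unit_lebesgue" "inv \<gamma> \<in> unit_lebesgue \<rightarrow>\<^sub>M unit_lebesgue"
      "\<delta> \<in> unit_lebesgue \<rightarrow>\<^sub>M unit_lebesgue"
    and bij: "bij \<gamma>" using \<gamma> \<delta> by (auto simp: nonsingular_def)
  have [simp]: "inv \<gamma> (\<gamma> x) = x" for x using bij by (simp add: bij_is_inj)
  let ?h = "\<lambda>x. pushforward_deriv \<gamma> x * pushforward_deriv \<delta> (inv \<gamma> x)"
  show "?h \<in> borel_measurable unit_lebesgue" by measurable
  show "?h x \<ge> 0" for x by (simp add: pushforward_deriv_nonneg)
  have "density unit_lebesgue (\<lambda>x. ennreal (?h x)) =
      density (density unit_lebesgue (\<lambda>x. ennreal (pushforward_deriv \<gamma> x)))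
        (\<lambda>x. ennreal (pushforward_deriv \<delta> (inv \<gamma> x)))"
    by (subst density_density_eq) (auto simp: ennreal_mult pushforward_deriv_nonneg)
  also have "\<dots> = density (distr unit_lebesgue unit_lebesgue \<gamma>)
      (\<lambda>x. ennreal (pushforward_deriv \<delta> (inv \<gamma> x)))"
    by (simp add: density_pushforward_deriv \<gamma>)
  also have "\<dots> = distr (density unit_lebesgue (\<lambda>x. ennreal (pushforward_deriv \<delta> x))) unit_lebesgue \<gamma>"
    by (subst density_distr) auto
  also have "\<dots> = distr unit_lebesgue unit_lebesgue (\<gamma> \<circ> \<delta>)"
    by (simp add: density_pushforward_deriv \<delta> distr_distr)
  finally show "density unit_lebesgue (\<lambda>x. ennreal (?h x)) =
      distr unit_lebesgue unit_lebesgue (\<gamma> \<circ> \<delta>)" .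
qed

lemma nonsingular_comp:
  assumes \<gamma>: "nonsingular \<gamma>" and \<delta>: "nonsingular \<delta>"
  shows "nonsingular (\<gamma> \<circ> \<delta>)"
proof -
  have ac: "absolutely_continuous unit_lebesgue (distr unit_lebesgue unit_lebesgue (f \<circ> g))"
    if "f \<in> unit_lebesgue \<rightarrow>\<^sub>M unit_lebesgue" "g \<in> unit_lebesgue \<rightarrow>\<^sub>M unit_lebesgue"
      "absolutely_continuous unit_lebesgue (distr unit_lebesgue unit_lebesgue f)"
      "absolutely_continuous unit_lebesgue (distr unit_lebesgue unit_lebesgue g)"
    for f g
    unfolding absolutely_continuous_def
  proof
    fix N assume N: "N \<in> null_sets unit_lebesgue"
    then have "f -` N \<inter> space unit_lebesgue \<in> null_sets unit_lebesgue"
      using that by (auto simp: absolutely_continuous_def null_sets_distr_iff)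
    then have "g -` (f -` N \<inter> space unit_lebesgue) \<inter> space unit_lebesgue \<in> null_sets unit_lebesgue"
      using that by (auto simp: absolutely_continuous_def null_sets_distr_iff)
    also have "g -` (f -` N \<inter> space unit_lebesgue) \<inter> space unit_lebesgue =
        (f \<circ> g) -` N \<inter> space unit_lebesgue"
      using measurable_space[OF that(2)] by auto
    finally show "N \<in> null_sets (distr unit_lebesgue unit_lebesgue (f \<circ> g))"
      using N measurable_comp[OF that(2,1)] by (simp add: null_sets_distr_iff null_setsD2)
  qed
  have "inv (\<gamma> \<circ> \<delta>) = inv \<delta> \<circ> inv \<gamma>"
    using assms by (auto simp: nonsingular_def o_inv_distrib)
  then show ?thesis
    using assms ac unfolding nonsingular_def by (auto intro: bij_comp measurable_comp)
qed

lemma koopman_rep_comp: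
  assumes \<gamma>: "nonsingular \<gamma>" and \<delta>: "nonsingular \<delta>"
  shows "koopman_rep s (\<gamma> \<circ> \<delta>) = koopman_rep s \<gamma> \<circ> koopman_rep s \<delta>"
proof
  fix \<xi>
  obtain f where f: "sq_integrable f" "\<xi> = abs_l2 f" by (rule l2_cases)
  have inv: "inv (\<gamma> \<circ> \<delta>) = inv \<delta> \<circ> inv \<gamma>"
    using assms by (auto simp: nonsingular_def o_inv_distrib)
  have "AE x in unit_lebesgue.
      koopman_fun s (\<gamma> \<circ> \<delta>) f x = koopman_fun s \<gamma> (koopman_fun s \<delta> f) x"
    using pushforward_deriv_comp[OF assms]
    by eventually_elim
      (simp add: koopman_fun_def inv powr_times_real pushforward_deriv_nonneg)
  then show "koopman_rep s (\<gamma> \<circ> \<delta>) \<xi> = (koopman_rep s \<gamma> \<circ> koopman_rep s \<delta>) \<xi>"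
    using f assms nonsingular_comp[OF assms]
    by (auto simp: koopman_rep_abs_l2 sq_integrable_koopman_fun intro!: abs_l2_eq)
qed

lemma nonsingular_id: "nonsingular id"
proof -
  have "distr unit_lebesgue unit_lebesgue id = unit_lebesgue" by (simp add: distr_id2 id_def)
  then show ?thesis by (simp add: nonsingular_def absolutely_continuous_def)
qed

lemma koopman_rep_id: "koopman_rep s id = id"
proof
  fix \<xi>
  obtain f where f: "sq_integrable f" "\<xi> = abs_l2 f" by (rule l2_cases)
  have "AE x in unit_lebesgue. pushforward_deriv id x = 1"
    by (rule pushforward_deriv_unique) (auto simp: distr_id2 id_def density_1)
  then have "AE x in unit_lebesgue. koopman_fun s id f x = f x"
    by eventually_elim (simp add: koopman_fun_def)
  then show "koopman_rep s id \<xi> = id \<xi>"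
    using f nonsingular_id
    by (auto simp: koopman_rep_abs_l2 sq_integrable_koopman_fun intro!: abs_l2_eq)
qed

lemma unitary_koopman_rep:
  assumes ns: "nonsingular \<gamma>"
  shows "unitary_l2 (koopman_rep s \<gamma>)"
proof -
  have "koopman_rep s \<gamma> (koopman_rep s (inv \<gamma>) \<xi>) = \<xi>" for \<xi>
    using koopman_rep_comp[OF ns nonsingular_inv[OF ns], of s] ns
    by (simp add: nonsingular_def bij_is_surj surj_iff[THEN iffD1] koopman_rep_id fun_eq_iff)
  then have "surj (koopman_rep s \<gamma>)" by (metis surjI)
  then show ?thesis
    using linear_koopman_rep[OF ns] inner_koopman_rep[OF ns] by (simp add: unitary_l2_def)
qed

end

theory Submission
  imports Defs
begin

text \<open>
  If \<open>s - t\<close> is a multiple of \<open>2 * pi / ln 2\<close>, then the two representations coincide, because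
  the Radon-Nikodym derivatives take values in the powers of 2.

  Conversely, let \<open>U\<close> intertwine them. For dyadic \<open>a < b\<close> the copy of the standard generator of
  \<open>F\<close> supported in \<open>[a, b]\<close> has no fixed vectors other than the functions vanishing on
  \<open>[a, b]\<close>, since it preserves no nonzero finite measure on \<open>(a, b)\<close>. Hence \<open>U\<close> is local, and
  \<open>m(J) = \<langle>U 1, 1\<^sub>J\<rangle> = \<langle>U 1\<^sub>J, 1\<^sub>J\<rangle>\<close> is additive over dyadic intervals \<open>J\<close>. Elements of \<open>F\<close> that
  are translations on \<open>J\<close> preserve \<open>m(J)\<close>, so the two halves of an interval have equal mass; elements
  of slope 1/2 on \<open>J\<close> give \<open>m(J) = 2 \<omega> m(J')\<close> for the left half \<open>J'\<close>, where
  \<open>\<omega> = 2\<^sup>i\<^sup>(\<^sup>s\<^sup>-\<^sup>t\<^sup>)\<close>. If \<open>\<omega> \<noteq> 1\<close>, then \<open>m = 0\<close> and \<open>U 1 = 0\<close>, a contradiction.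
\<close>

section \<open>Elements of Thompson's group supported in a dyadic interval\<close>

lemma dyadic_rationalsI: "x = of_int m / 2 ^ n \<Longrightarrow> x \<in> dyadic_rationals"
  unfolding dyadic_rationals_def by blast

lemma dyadic_rationals_of_int [simp]: "of_int m \<in> dyadic_rationals"
  by (rule dyadic_rationalsI[of _ m 0]) simp

lemma dyadic_rationals_uminus: "x \<in> dyadic_rationals \<Longrightarrow> - x \<in> dyadic_rationals"
  unfolding dyadic_rationals_def by (force intro: exI[of _ "- m" for m])

lemma dyadic_rationals_add:
  assumes "x \<in> dyadic_rationals" "y \<in> dyadic_rationals"
  shows "x + y \<in> dyadic_rationals"
proof -
  obtain m n m' n' where "x = of_int m / 2 ^ n" "y = of_int m' / 2 ^ n'"
    using assms by (auto simp: dyadic_rationals_def)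
  then have "x + y = of_int (m * 2 ^ n' + m' * 2 ^ n) / 2 ^ (n + n')"
    by (simp add: add_divide_distrib power_add)
  then show ?thesis by (rule dyadic_rationalsI)
qed

lemma dyadic_rationals_diff:
  "x \<in> dyadic_rationals \<Longrightarrow> y \<in> dyadic_rationals \<Longrightarrow> x - y \<in> dyadic_rationals"
  using dyadic_rationals_add[of x "- y"] dyadic_rationals_uminus[of y] by simp

lemma dyadic_rationals_double: "x \<in> dyadic_rationals \<Longrightarrow> 2 * x \<in> dyadic_rationals"
  using dyadic_rationals_add[of x x] by simp

lemma dyadic_rationals_half:
  assumes "x \<in> dyadic_rationals" shows "x / 2 \<in> dyadic_rationals"
proof -
  obtain m n where "x = of_int m / 2 ^ n" using assms by (auto simp: dyadic_rationals_def)
  then show ?thesis by (intro dyadic_rationalsI[of _ m "Suc n"]) simp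
qed

lemma dyadic_rationals_quarter: "x \<in> dyadic_rationals \<Longrightarrow> x / 4 \<in> dyadic_rationals"
  using dyadic_rationals_half[OF dyadic_rationals_half[of x]] by simp

lemmas dyadic_intros =
  dyadic_rationals_add dyadic_rationals_diff dyadic_rationals_half dyadic_rationals_double
  dyadic_rationals_quarter

lemma dyadic_rationals_divide_power: "x \<in> dyadic_rationals \<Longrightarrow> x / 2 ^ n \<in> dyadic_rationals"
proof (induction n)
  case (Suc n)
  then show ?case using dyadic_rationals_half[of "x / 2 ^ n"] by (simp add: mult.commute)
qed simp

lemma dyadic_rationals_of_nat_mult: "x \<in> dyadic_rationals \<Longrightarrow> of_nat j * x \<in> dyadic_rationals"
proof (induction j)
  case 0
  show ?case using dyadic_rationals_of_int[of 0] by simp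
next
  case (Suc j)
  then show ?case using dyadic_rationals_add[of x "of_nat j * x"] by (simp add: algebra_simps)
qed

lemma dyadic_rationals_between:
  fixes x y :: real
  assumes "x < y" obtains d where "d \<in> dyadic_rationals" "x < d" "d < y"
proof -
  obtain n :: nat where n: "1 / (y - x) < 2 ^ n"
    using real_arch_pow[of 2 "1 / (y - x)"] by auto
  \<comment> \<open>The first multiple of 1/2^n strictly above \<open>x\<close>; the mesh 1/2^n is
    smaller than \<open>y - x\<close>, so it stays below \<open>y\<close>.\<close>
  define d where "d = of_int (\<lfloor>x * 2 ^ n\<rfloor> + 1) / (2::real) ^ n"
  have "1 < (y - x) * 2 ^ n" using n assms by (simp add: field_simps)
  then have "x * 2 ^ n < \<lfloor>x * 2 ^ n\<rfloor> + 1" "\<lfloor>x * 2 ^ n\<rfloor> + 1 < y * 2 ^ n"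
    by (simp_all add: algebra_simps) linarith+
  then have "x < d" "d < y" by (simp_all add: d_def field_simps)
  moreover have "d \<in> dyadic_rationals" unfolding d_def
    by (rule dyadic_rationalsI[of _ "\<lfloor>x * 2 ^ n\<rfloor> + 1" n]) simp
  ultimately show ?thesis using that by blast
qed

section \<open>The generator of F on an interval, and its inverse\<close>

text \<open>
  The standard generator of \<open>F\<close> transported to \<open>[a, b]\<close>. It is convex there with slopes 1/2, 1, 2;
  the outer \<open>min\<close> makes the formula valid on the whole line.
\<close>

definition contraction :: "real \<Rightarrow> real \<Rightarrow> real \<Rightarrow> real"
  where "contraction a b x = min x (max ((a + x) / 2) (max (x - (b - a) / 4) (2 * x - b)))"

text \<open>For increasing bijections of the line the inverse of a minimum is the maximum of the
  inverses, and vice versa. The formula is \<open>contraction\<close> inverted branch by branch in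
  this way.\<close>

definition expansion :: "real \<Rightarrow> real \<Rightarrow> real \<Rightarrow> real"
  where "expansion a b y = max y (min (2 * y - a) (min (y + (b - a) / 4) ((y + b) / 2)))"

context
  fixes a b :: real
  assumes ab: "a < b"
begin

lemma contraction_outside: "x \<notin> {a<..<b} \<Longrightarrow> contraction a b x = x"
  using ab unfolding contraction_def min_def max_def by (auto simp: field_simps)

lemma contraction_left: "a \<le> x \<Longrightarrow> x \<le> (a + b) / 2 \<Longrightarrow> contraction a b x = (a + x) / 2"
  using ab unfolding contraction_def min_def max_def by (simp add: field_simps)

lemma contraction_middle:
  "(a + b) / 2 \<le> x \<Longrightarrow> x \<le> (a + 3 * b) / 4 \<Longrightarrow> contraction a b x = x - (b - a) / 4"
  using ab unfolding contraction_def min_def max_def by (simp add: field_simps)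

lemma contraction_right: "(a + 3 * b) / 4 \<le> x \<Longrightarrow> x \<le> b \<Longrightarrow> contraction a b x = 2 * x - b"
  using ab unfolding contraction_def min_def max_def by (simp add: field_simps)

lemma contraction_expansion: "contraction a b (expansion a b y) = y"
  using ab unfolding contraction_def expansion_def min_def max_def by (simp add: field_simps)

lemma expansion_contraction: "expansion a b (contraction a b x) = x"
  using ab unfolding contraction_def expansion_def min_def max_def by (simp add: field_simps)

lemma inv_contraction: "inv (contraction a b) = expansion a b"
  by (rule inv_equality) (simp_all add: contraction_expansion expansion_contraction)

lemma strict_mono_contraction: "strict_mono (contraction a b)"
  unfolding strict_mono_def contraction_def min_def max_def by (simp add: field_simps)

lemma strict_mono_expansion: "strict_mono (expansion a b)"
  unfolding strict_mono_def expansion_def min_def max_def by (simp add: field_simps)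

lemma expansion_outside: "y \<notin> {a<..<b} \<Longrightarrow> expansion a b y = y"
  using contraction_outside expansion_contraction by metis

lemma expansion_left:
  "a \<le> y \<Longrightarrow> y \<le> (3 * a + b) / 4 \<Longrightarrow> expansion a b y = 2 * y - a"
  using ab unfolding expansion_def min_def max_def by (simp add: field_simps)

lemma expansion_right: "(a + b) / 2 \<le> y \<Longrightarrow> y \<le> b \<Longrightarrow> expansion a b y = (y + b) / 2"
  using ab unfolding expansion_def min_def max_def by (simp add: field_simps)

text \<open>Piecewise linearity, differentiability off the four break points and the values of the
  slopes are all read off from this one statement.\<close>

lemma contraction_affine_piece:
  assumes "x < y" "{x<..<y} \<inter> {a, (a + b) / 2, (a + 3 * b) / 4, b} = {}"
  shows "\<exists>m c. m \<in> {1/2, 1, 2} \<and> (\<forall>z\<in>{x..y}. contraction a b z = m * z + c)"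
proof -
  have sep: "y \<le> u \<or> u \<le> x" if "u \<in> {a, (a + b) / 2, (a + 3 * b) / 4, b}" for u
    using assms(2) that by (meson disjoint_iff greaterThanLessThan_iff not_le)
  consider "y \<le> a" | "b \<le> x" | "a \<le> x" "y \<le> (a + b) / 2" | "(a + b) / 2 \<le> x" "y \<le> (a + 3 * b) / 4"
    | "(a + 3 * b) / 4 \<le> x" "y \<le> b"
    using sep[of a] sep[of "(a + b) / 2"] sep[of "(a + 3 * b) / 4"] sep[of b] by auto
  then show ?thesis
  proof cases
    case 1
    then show ?thesis by (intro exI[of _ 1] exI[of _ 0]) (auto intro: contraction_outside)
  next
    case 2
    then show ?thesis by (intro exI[of _ 1] exI[of _ 0]) (auto intro: contraction_outside)
  next
    case 3
    then show ?thesis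
      by (intro exI[of _ "1/2"] exI[of _ "a/2"]) (auto simp: contraction_left field_simps)
  next
    case 4
    then show ?thesis
      by (intro exI[of _ 1] exI[of _ "- (b - a) / 4"]) (auto simp: contraction_middle field_simps)
  next
    case 5
    then show ?thesis by (intro exI[of _ 2] exI[of _ "- b"]) (auto simp: contraction_right)
  qed
qed

end

section \<open>Verification of the defining conditions of F\<close>

text \<open>Derivatives within a nondegenerate closed interval are unique, at its endpoints too. So
  the slope is determined even where \<open>x\<close> is a break point and the piece lies on one
  side of it only.\<close>

lemma affine_piece_derivative:
  fixes f :: "real \<Rightarrow> real"
  assumes aff: "\<And>z. z \<in> {p..q} \<Longrightarrow> f z = m * z + c" and "p < q" "x \<in> {p..q}" "{p..q} \<subseteq> S"
    and d: "(f has_real_derivative d) (at x within S)"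
  shows "d = m"
proof -
  have "(f has_real_derivative d) (at x within {p..q})"
    using d \<open>{p..q} \<subseteq> S\<close> by (rule has_field_derivative_subset)
  moreover have "((\<lambda>z. m * z + c) has_real_derivative m) (at x within {p..q})"
    by (auto intro!: derivative_eq_intros)
  then have "(f has_real_derivative m) (at x within {p..q})"
    by (rule has_field_derivative_transform_within[where d = 1]) (use assms in auto)
  ultimately have "(f has_vector_derivative d) (at x within {p..q})"
      "(f has_vector_derivative m) (at x within {p..q})"
    by (simp_all add: has_real_derivative_iff_has_vector_derivative)
  then show ?thesis
    using vector_derivative_unique_within_closed_interval[of p q x f d m] assms by simp
qed

lemma finite_gap_right:
  fixes x :: real
  assumes "finite B" "x < u" shows "\<exists>y. x < y \<and> y \<le> u \<and> {x<..<y} \<inter> B = {}"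
proof (intro exI conjI)
  let ?C = "insert u (B \<inter> {x<..})"
  have fin: "finite ?C" using assms by simp
  show "x < Min ?C" using fin assms by (subst Min_gr_iff) auto
  show "Min ?C \<le> u" using fin by (intro Min_le) auto
  show "{x<..<Min ?C} \<inter> B = {}" using fin by auto
qed

lemma finite_gap_left:
  fixes x :: real
  assumes "finite B" "l < x" shows "\<exists>y. y < x \<and> l \<le> y \<and> {y<..<x} \<inter> B = {}"
proof (intro exI conjI)
  let ?C = "insert l (B \<inter> {..<x})"
  have fin: "finite ?C" using assms by simp
  show "Max ?C < x" using fin assms by (subst Max_less_iff) auto
  show "l \<le> Max ?C" using fin by (intro Max_ge) auto
  show "{Max ?C<..<x} \<inter> B = {}" using fin by auto
qed

lemma contraction_in_thompson_F:
  assumes "a \<in> dyadic_rationals" "b \<in> dyadic_rationals" "0 \<le> a" "a < b" "b \<le> 1"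
  shows "contraction a b \<in> thompson_F"
proof -
  let ?B = "{a, (a + b) / 2, (a + 3 * b) / 4, b}"
  note ab = \<open>a < b\<close>
  have fB: "finite ?B" by simp
  \<comment> \<open>Break points need a slope as well: for \<open>a = 0\<close> the map has a
    derivative at 0 within the unit interval. The piece is taken to the right of the point, and to
    the left only at 1, where there is no room on the right.\<close>
  have piece: "\<exists>p q m c. p < q \<and> x \<in> {p..q} \<and> {p..q} \<subseteq> {0..1} \<and> m \<in> {1/2, 1, 2} \<and>
      (\<forall>z\<in>{p..q}. contraction a b z = m * z + c)" if x: "x \<in> {0..1}" for x
  proof (cases "x = 1")
    case False
    then obtain y where y: "x < y" "y \<le> 1" "{x<..<y} \<inter> ?B = {}"
      using finite_gap_right[OF fB, of x 1] x by force
    moreover have "x \<in> {x..y}" "{x..y} \<subseteq> {0..1}" using x y by auto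
    ultimately show ?thesis using contraction_affine_piece[OF ab y(1,3)] by blast
  next
    case True
    then obtain y where y: "y < x" "0 \<le> y" "{y<..<x} \<inter> ?B = {}"
      using finite_gap_left[OF fB, of 0 x] zero_less_one by blast
    moreover have "x \<in> {y..x}" "{y..x} \<subseteq> {0..1}" using x y by auto
    ultimately show ?thesis using contraction_affine_piece[OF ab y(1,3)] by blast
  qed
  have maps: "contraction a b x \<in> {0..1}" "expansion a b x \<in> {0..1}" if "x \<in> {0..1}" for x
    using that assms contraction_outside[OF ab, of 0] contraction_outside[OF ab, of 1]
      expansion_outside[OF ab, of 0] expansion_outside[OF ab, of 1]
      strict_mono_less_eq[OF strict_mono_contraction[OF ab], of 0 x]
      strict_mono_less_eq[OF strict_mono_contraction[OF ab], of x 1]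
      strict_mono_less_eq[OF strict_mono_expansion[OF ab], of 0 x]
      strict_mono_less_eq[OF strict_mono_expansion[OF ab], of x 1]
    by auto
  have "contraction a b x = x" if "x \<notin> {0..1}" for x
    using that assms by (intro contraction_outside) auto
  moreover have "homeomorphism {0..1} {0..1} (contraction a b) (expansion a b)"
  proof (rule homeomorphismI)
    show "continuous_on {0..1} (contraction a b)" "continuous_on {0..1} (expansion a b)"
      unfolding contraction_def expansion_def by (auto intro!: continuous_intros)
  qed (use maps in \<open>auto simp: contraction_expansion[OF ab] expansion_contraction[OF ab]\<close>)
  moreover have "strict_mono_on {0..1} (contraction a b)"
    using strict_mono_contraction[OF ab] by (auto simp: strict_mono_on_def strict_mono_def)
  moreover have "piecewise_linear_on {0..1} (contraction a b)"
    unfolding piecewise_linear_on_def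
  proof (rule exI[of _ ?B], intro conjI fB allI impI)
    fix u v assume "u < v" "{u<..<v} \<inter> ?B = {}"
    then show "\<exists>m c. \<forall>z\<in>{u..v}. contraction a b z = m * z + c"
      using contraction_affine_piece[OF ab, of u v] by metis
  qed
  moreover have "contraction a b ` (dyadic_rationals \<inter> {0..1}) = dyadic_rationals \<inter> {0..1}"
  proof -
    have dy: "contraction a b x \<in> dyadic_rationals" "expansion a b x \<in> dyadic_rationals"
      if "x \<in> dyadic_rationals" for x
      using that assms by (auto simp: contraction_def expansion_def min_def max_def intro!: dyadic_intros)
    show ?thesis
    proof
      show "contraction a b ` (dyadic_rationals \<inter> {0..1}) \<subseteq> dyadic_rationals \<inter> {0..1}"
        using dy maps by blast
      show "dyadic_rationals \<inter> {0..1} \<subseteq> contraction a b ` (dyadic_rationals \<inter> {0..1})"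
      proof
        fix y assume "y \<in> dyadic_rationals \<inter> {0..1}"
        then have "expansion a b y \<in> dyadic_rationals \<inter> {0..1}" using dy maps by blast
        then show "y \<in> contraction a b ` (dyadic_rationals \<inter> {0..1})"
          using contraction_expansion[OF ab, of y] by (metis imageI)
      qed
    qed
  qed
  moreover have nd: "nondiff_points (contraction a b) \<subseteq> ?B"
  proof
    fix x assume x: "x \<in> nondiff_points (contraction a b)"
    show "x \<in> ?B"
    proof (rule ccontr)
      assume nB: "x \<notin> ?B"
      obtain y where y: "x < y" "{x<..<y} \<inter> ?B = {}" using finite_gap_right[OF fB, of x "x + 1"] less_add_one by blast
      obtain z where z: "z < x" "{z<..<x} \<inter> ?B = {}" using finite_gap_left[OF fB, of "x - 1" x] diff_less_eq less_add_one by blast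
      \<comment> \<open>Since \<open>x\<close> is no break point, the gaps on its two sides merge
        into a single affine piece around it.\<close>
      have "{z<..<y} = {z<..<x} \<union> {x} \<union> {x<..<y}" using y(1) z(1) by auto
      then have "{z<..<y} \<inter> ?B = {}" using nB y(2) z(2) by blast
      then obtain m c where mc: "\<forall>w\<in>{z..y}. contraction a b w = m * w + c"
        using contraction_affine_piece[OF ab, of z y] less_trans[OF z(1) y(1)] by blast
      have "((\<lambda>w. m * w + c) has_real_derivative m) (at x)"
        by (auto intro!: derivative_eq_intros)
      then have "(contraction a b has_real_derivative m) (at x)"
        by (rule has_field_derivative_transform_within_open[where S = "{z<..<y}"]) (use y(1) z(1) mc in auto)
      then have "contraction a b differentiable (at x within {0..1})"
        using real_differentiable_def differentiable_at_withinI by blast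
      then show False using x by (simp add: nondiff_points_def)
    qed
  qed
  moreover have "finite (nondiff_points (contraction a b))"
    using nd fB by (rule finite_subset)
  moreover have "?B \<subseteq> dyadic_rationals"
  proof -
    have "3 * b = b + 2 * b" by simp
    then have "3 * b \<in> dyadic_rationals" using assms by (metis dyadic_intros(1,4))
    then show ?thesis using assms by (auto intro!: dyadic_intros)
  qed
  moreover have "\<exists>k::int. d = 2 powi k"
    if x: "x \<in> {0..1}" and d: "(contraction a b has_real_derivative d) (at x within {0..1})" for x d
  proof -
    obtain p q m c where "p < q" "x \<in> {p..q}" "{p..q} \<subseteq> {0..1}" and m: "m \<in> {1/2, 1, 2::real}"
      and "\<forall>z\<in>{p..q}. contraction a b z = m * z + c" using piece[OF x] by blast
    then have "d = m" using affine_piece_derivative[OF _ _ _ _ d] by blast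
    moreover have "1/2 = (2::real) powi (- 1)" "1 = (2::real) powi 0" "2 = (2::real) powi 1"
      by (simp_all add: power_int_minus)
    ultimately show ?thesis using m by blast
  qed
  ultimately show ?thesis unfolding thompson_F_def by blast
qed

section \<open>Action on indicator functions and fixed vectors\<close>

lemma integral_unit_lebesgue:
  fixes f :: "real \<Rightarrow> 'b::{banach, second_countable_topology}"
  shows "(\<integral>x. f x \<partial>unit_lebesgue) = (\<integral>x. indicator {0..1} x *\<^sub>R f x \<partial>lborel)"
  unfolding unit_lebesgue_def by (rule integral_restrict_space) simp

lemma integrable_unit_lebesgue:
  fixes f :: "real \<Rightarrow> 'b::{banach, second_countable_topology}"
  shows "integrable unit_lebesgue f \<longleftrightarrow> integrable lborel (\<lambda>x. indicator {0..1} x *\<^sub>R f x)"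
  unfolding unit_lebesgue_def by (rule integrable_restrict_space) simp

lemma measurable_unit_lebesgue_borel:
  "f \<in> borel_measurable borel \<Longrightarrow> f \<in> borel_measurable unit_lebesgue"
  unfolding unit_lebesgue_def by (intro measurable_restrict_space1) simp

text \<open>The pushforward restricted to the image of an affine piece is Lebesgue measure scaled by
  1/m. Both candidate densities are cut off to this image, where alone the map is known, and are
  compared by their integrals over all measurable sets.\<close>

lemma pushforward_deriv_affine:
  assumes ns: "nonsingular \<gamma>" and aff: "\<And>x. x \<in> {p..q} \<Longrightarrow> \<gamma> x = m * x + c"
    and pq: "0 \<le> p" "q \<le> 1" and m: "m > 0"
  shows "AE x in unit_lebesgue. x \<in> {m * p + c..m * q + c} \<longrightarrow> pushforward_deriv \<gamma> x = 1 / m"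
proof -
  interpret finite_measure unit_lebesgue by (rule finite_unit_lebesgue)
  let ?K = "{m * p + c..m * q + c}"
  have bij: "bij \<gamma>" and meas [measurable]: "\<gamma> \<in> unit_lebesgue \<rightarrow>\<^sub>M unit_lebesgue"
    using ns by (auto simp: nonsingular_def)
  have K [measurable]: "(indicator ?K :: real \<Rightarrow> real) \<in> borel_measurable unit_lebesgue"
    by (intro measurable_unit_lebesgue_borel) simp
  have intD: "integrable unit_lebesgue (pushforward_deriv \<gamma>)"
    using integrable_pushforward(1)[OF ns, of "\<lambda>_. 1::real"] by simp
  have "AE x in unit_lebesgue. indicat_real ?K x * pushforward_deriv \<gamma> x = indicat_real ?K x * (1 / m)"
  proof (rule density_unique_banach)
    show "integrable unit_lebesgue (\<lambda>x. indicat_real ?K x * pushforward_deriv \<gamma> x)"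
      by (rule Bochner_Integration.integrable_bound[OF intD], measurable) (auto simp: indicator_def)
    show "integrable unit_lebesgue (\<lambda>x. indicat_real ?K x * (1 / m))"
      using m by (intro integrable_const_bound[where B = "1 / m"] AE_I2, simp add: indicator_def) measurable
    fix A assume A: "A \<in> sets unit_lebesgue"
    then have Asub: "A \<subseteq> {0..1}" and Abor: "A \<in> sets borel" by (auto simp: sets_unit_lebesgue)
    let ?C = "A \<inter> ?K"
    have Cbor [measurable]: "?C \<in> sets borel" using Abor by simp
    let ?h = "\<lambda>y. indicat_real ?C (\<gamma> y)"
    have [measurable]: "(indicator ?C :: real \<Rightarrow> real) \<in> borel_measurable unit_lebesgue"
      by (intro measurable_unit_lebesgue_borel) simp
    have hm: "?h \<in> borel_measurable unit_lebesgue" by measurable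
    \<comment> \<open>Injectivity on the whole line keeps points outside the piece from landing in
      its image.\<close>
    have inK: "\<gamma> y \<in> ?K \<longleftrightarrow> y \<in> {p..q}" for y
    proof
      assume y: "\<gamma> y \<in> ?K"
      define z where "z = (\<gamma> y - c) / m"
      have z: "z \<in> {p..q}" using y m by (auto simp: z_def field_simps)
      then have "\<gamma> z = \<gamma> y" using aff[of z] m by (simp add: z_def)
      then show "y \<in> {p..q}" using z bij by (metis bij_is_inj inj_eq)
    next
      assume "y \<in> {p..q}"
      then show "\<gamma> y \<in> ?K" using aff[of y] m by auto
    qed
    \<comment> \<open>Hence the map may be replaced by its affine formula on all of the line, and
      the affine change of variables for \<open>lborel\<close> applies.\<close>
    have h: "?h y = indicat_real ?C (c + m * y)" for y
    proof (cases "y \<in> {p..q}")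
      case True
      then show ?thesis using aff[of y] by (simp add: add.commute)
    next
      case False
      then have "c + m * y \<notin> ?K" using m by (auto simp: add.commute)
      then show ?thesis using inK[of y] False by (metis Int_iff indicator_simps(2))
    qed
    have "(LINT x:A|unit_lebesgue. indicat_real ?K x * pushforward_deriv \<gamma> x)
        = (\<integral>x. pushforward_deriv \<gamma> x *\<^sub>R ?h (inv \<gamma> x) \<partial>unit_lebesgue)"
      unfolding set_lebesgue_integral_def using bij
      by (intro Bochner_Integration.integral_cong refl)
        (simp add: surj_f_inv_f bij_is_surj indicator_def)
    also have "\<dots> = (\<integral>x. ?h x \<partial>unit_lebesgue)" by (rule integrable_pushforward(2)[OF ns hm])
    also have "\<dots> = (\<integral>x. indicat_real ?C (c + m * x) \<partial>lborel)"
      unfolding integral_unit_lebesgue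
    proof (intro Bochner_Integration.integral_cong refl)
      fix y
      have "?h y = 0" if "y \<notin> {0..1}"
        using that inK[of y] pq by (auto simp: indicator_def)
      then show "indicat_real {0..1} y *\<^sub>R ?h y = indicat_real ?C (c + m * y)"
        unfolding h[symmetric] by (cases "y \<in> {0..1}") auto
    qed
    also have "\<dots> = (1 / m) * (\<integral>x. indicat_real ?C x \<partial>lborel)"
      using lborel_integral_real_affine[of m "indicat_real ?C" c] m by simp
    also have "(\<integral>x. indicat_real ?C x \<partial>lborel) = (\<integral>x. indicat_real ?C x \<partial>unit_lebesgue)"
      unfolding integral_unit_lebesgue using Asub
      by (intro Bochner_Integration.integral_cong refl) (auto simp: indicator_def)
    also have "(1 / m) * \<dots> = (LINT x:A|unit_lebesgue. indicat_real ?K x * (1 / m))"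
      unfolding set_lebesgue_integral_def
      by (subst Bochner_Integration.integral_mult_right_zero[symmetric])
        (auto simp: indicator_def intro!: Bochner_Integration.integral_cong)
    finally show "(LINT x:A|unit_lebesgue. indicat_real ?K x * pushforward_deriv \<gamma> x)
        = (LINT x:A|unit_lebesgue. indicat_real ?K x * (1 / m))" .
  qed
  then show ?thesis by eventually_elim (auto simp: indicator_def)
qed

section \<open>The operators on indicator functions\<close>

lemma abs_l2_eq_iff:
  assumes "sq_integrable f" "sq_integrable g"
  shows "abs_l2 f = abs_l2 g \<longleftrightarrow> (AE x in unit_lebesgue. f x = g x)"
  using Quotient_rel[OF Quotient_l2, of f g] assms by (auto simp: l2_rel_def)

lemma sq_integrable_integrable:
  assumes "sq_integrable f" shows "integrable unit_lebesgue f"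
proof -
  interpret finite_measure unit_lebesgue by (rule finite_unit_lebesgue)
  have "integrable unit_lebesgue (\<lambda>x. 1 + (cmod (f x))\<^sup>2)"
    using assms by (auto simp: sq_integrable_def)
  moreover have "f \<in> borel_measurable unit_lebesgue" using assms by (simp add: sq_integrable_def)
  moreover have "cmod z \<le> 1 + (cmod z)\<^sup>2" for z
    using zero_le_power2[of "cmod z - 1 / 2"] by (simp add: power2_diff) (simp add: power_divide)
  then have "AE x in unit_lebesgue. norm (f x) \<le> norm (1 + (cmod (f x))\<^sup>2)"
    by (simp add: abs_of_nonneg)
  ultimately show ?thesis by (rule Bochner_Integration.integrable_bound)
qed

lemma measurable_indicator_unit_lebesgue [measurable]:
  fixes A :: "real set"
  assumes "A \<in> sets borel"
  shows "(indicator A :: real \<Rightarrow> 'b::{real_normed_vector, zero_neq_one}) \<in> borel_measurable unit_lebesgue"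
  using assms by (intro measurable_unit_lebesgue_borel) simp

lemma sq_integrable_indicator:
  assumes "A \<in> sets borel" shows "sq_integrable (indicator A)"
proof -
  interpret finite_measure unit_lebesgue by (rule finite_unit_lebesgue)
  have "(\<lambda>x. (cmod (indicator A x))\<^sup>2) = indicat_real A"
    by (auto simp: fun_eq_iff indicator_def)
  then show ?thesis
    using assms unfolding sq_integrable_def
    by (auto intro!: integrable_const_bound[where B = 1])
qed

text \<open>Outside (a, b) the map is the identity and its derivative is 1, by the affine case with
  slope 1 on [0, a] and [b, 1]. Inside (a, b), both a point and its preimage miss
  \<open>A\<close>.\<close>

lemma koopman_rep_indicator_fixed:
  assumes ns: "nonsingular (contraction a b)" and ab: "0 \<le> a" "a < b" "b \<le> 1"
    and A: "A \<in> sets borel" "A \<inter> {a<..<b} = {}"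
  shows "koopman_rep s (contraction a b) (abs_l2 (indicator A)) = abs_l2 (indicator A)"
proof -
  have "AE x in unit_lebesgue. x \<in> {0..a} \<longrightarrow> pushforward_deriv (contraction a b) x = 1"
    using pushforward_deriv_affine[OF ns, of 0 a 1 0] ab by (auto simp: contraction_outside)
  moreover have "AE x in unit_lebesgue. x \<in> {b..1} \<longrightarrow> pushforward_deriv (contraction a b) x = 1"
    using pushforward_deriv_affine[OF ns, of b 1 1 0] ab by (auto simp: contraction_outside)
  moreover have "AE x in unit_lebesgue. x \<in> {0..1}"
    using AE_space[of unit_lebesgue] by (simp add: space_unit_lebesgue)
  ultimately have "AE x in unit_lebesgue.
      koopman_fun s (contraction a b) (indicator A) x = indicator A x"
  proof eventually_elim
    case (elim x)
    show ?case
    proof (cases "x \<in> {a<..<b}")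
      case True
      then have "contraction a b (expansion a b x) \<in> {a<..<b}"
        using ab by (simp add: contraction_expansion)
      then have "expansion a b x \<in> {a<..<b}" using contraction_outside[of a b] ab by metis
      then have "expansion a b x \<notin> A" "x \<notin> A" using True A by auto
      then show ?thesis by (simp add: koopman_fun_def inv_contraction ab)
    next
      case False
      then show ?thesis using elim ab
        by (auto simp: koopman_fun_def inv_contraction expansion_outside)
    qed
  qed
  then show ?thesis
    using A ns by (simp add: koopman_rep_abs_l2 abs_l2_eq_iff sq_integrable_indicator sq_integrable_koopman_fun)
qed

text \<open>The derivative is the constant 1/m on the image of the piece, so the operator acts on
  this indicator by moving the interval and multiplying by a scalar. The dependence on
  \<open>s\<close> sits in the phase of that scalar.\<close>

lemma koopman_rep_indicator_affine:
  assumes ns: "nonsingular \<gamma>" and aff: "\<And>x. x \<in> {p..q} \<Longrightarrow> \<gamma> x = m * x + c"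
    and pq: "0 \<le> p" "q \<le> 1" and m: "m > 0"
  shows "koopman_rep s \<gamma> (abs_l2 (indicator {p..q})) =
    scale_l2 (complex_of_real (1 / m) powr Complex (1/2) s) (abs_l2 (indicator {m * p + c..m * q + c}))"
proof -
  have bij: "bij \<gamma>" using ns by (simp add: nonsingular_def)
  have inK: "inv \<gamma> x \<in> {p..q} \<longleftrightarrow> x \<in> {m * p + c..m * q + c}" for x
  proof
    assume y: "inv \<gamma> x \<in> {p..q}"
    have "x = m * inv \<gamma> x + c" using aff[OF y] bij by (simp add: surj_f_inv_f bij_is_surj)
    moreover have "m * p \<le> m * inv \<gamma> x" "m * inv \<gamma> x \<le> m * q" using y m by auto
    ultimately show "x \<in> {m * p + c..m * q + c}" by (metis add_le_cancel_right atLeastAtMost_iff)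
  next
    assume x: "x \<in> {m * p + c..m * q + c}"
    then have z: "(x - c) / m \<in> {p..q}" using m by (auto simp: field_simps)
    then have "\<gamma> ((x - c) / m) = x" using aff[of "(x - c) / m"] m by simp
    then have "inv \<gamma> x = (x - c) / m" using bij by (metis bij_inv_eq_iff)
    then show "inv \<gamma> x \<in> {p..q}" using z by simp
  qed
  have D: "AE x in unit_lebesgue. x \<in> {m * p + c..m * q + c} \<longrightarrow> pushforward_deriv \<gamma> x = 1 / m"
    by (rule pushforward_deriv_affine[OF ns _ pq m]) (rule aff)
  have "AE x in unit_lebesgue. koopman_fun s \<gamma> (indicator {p..q}) x =
      complex_of_real (1 / m) powr Complex (1/2) s * indicator {m * p + c..m * q + c} x"
    using D
    by eventually_elim (use inK in \<open>auto simp: koopman_fun_def indicator_def\<close>)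
  then show ?thesis
    using ns by (simp add: koopman_rep_abs_l2 scale_abs_l2 abs_l2_eq_iff sq_integrable_indicator
      sq_integrable_koopman_fun sq_integrable_scale)
qed

section \<open>Criteria for vanishing almost everywhere\<close>

text \<open>Half-lines are an intersection-stable generator of the Borel sets. Vanishing of the
  integral passes to complements and countable disjoint unions, hence to all Borel sets.\<close>

lemma AE_zero_if_integral_atMost_zero:
  fixes g :: "real \<Rightarrow> 'b::{banach, second_countable_topology}"
  assumes int: "integrable unit_lebesgue g"
    and zero: "\<And>y. (LINT x:{..y}|unit_lebesgue. g x) = 0"
  shows "AE x in unit_lebesgue. g x = 0"
proof -
  interpret finite_measure unit_lebesgue by (rule finite_unit_lebesgue)
  \<comment> \<open>The generator consists of subsets of the line, the measurable sets of
    \<open>unit_lebesgue\<close> of subsets of the unit interval; intersecting with the latter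
    mediates between them.\<close>
  have cap: "(LINT x:(A \<inter> {0..1})|unit_lebesgue. g x) = (LINT x:A|unit_lebesgue. g x)" for A
    unfolding set_lebesgue_integral_def
    by (intro Bochner_Integration.integral_cong refl)
      (auto simp: indicator_def space_unit_lebesgue)
  have si: "set_integrable unit_lebesgue A g" if "A \<in> sets borel" for A
  proof -
    have "A \<inter> {0..1} \<in> sets unit_lebesgue" using that by (simp add: sets_unit_lebesgue)
    then have "integrable unit_lebesgue (\<lambda>x. indicator (A \<inter> {0..1}) x *\<^sub>R g x)"
      using int by (rule integrable_mult_indicator)
    then show ?thesis unfolding set_integrable_def
      by (subst Bochner_Integration.integrable_cong[OF refl, where g = "\<lambda>x. indicator (A \<inter> {0..1}) x *\<^sub>R g x"])
        (auto simp: indicator_def space_unit_lebesgue)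
  qed
  have top: "(LINT x:UNIV|unit_lebesgue. g x) = 0"
    using zero[of 1] cap[of "{..1}"] cap[of UNIV] by (simp add: Int_absorb1)
  have all: "(LINT x:A|unit_lebesgue. g x) = 0" if "A \<in> sigma_sets UNIV (range (\<lambda>a::real. {..a}))" for A
  proof -
    have bor: "sigma_sets UNIV (range (\<lambda>a::real. {..a})) = sets borel"
      by (simp add: borel_eq_atMost)
    have "Int_stable (range (\<lambda>a::real. {..a}))" by (auto simp: Int_stable_def)
    then show ?thesis using subset_UNIV[of "range (\<lambda>a::real. {..a})", folded Pow_UNIV] that
    proof (induction rule: sigma_sets_induct_disjoint)
      case (basic A)
      then show ?case using zero by auto
    next
      case empty
      show ?case by (simp add: set_lebesgue_integral_def)
    next
      case (compl A)
      then have "(LINT x:A \<union> (UNIV - A)|unit_lebesgue. g x) =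
          (LINT x:A|unit_lebesgue. g x) + (LINT x:(UNIV - A)|unit_lebesgue. g x)"
        by (intro set_integral_Un si) (auto simp: bor)
      then show ?case using compl top by simp
    next
      case (union A)
      then have m: "A i \<inter> {0..1} \<in> sets unit_lebesgue" for i
        by (auto simp: bor sets_unit_lebesgue)
      have "(LINT x:(\<Union>i. A i \<inter> {0..1})|unit_lebesgue. g x) =
          (\<Sum>i. (LINT x:(A i \<inter> {0..1})|unit_lebesgue. g x))"
      proof (rule lebesgue_integral_countable_add)
        show "A i \<inter> {0..1} \<inter> (A j \<inter> {0..1}) = {}" if "i \<noteq> j" for i j
          using union(1) that by (auto simp: disjoint_family_on_def)
        show "set_integrable unit_lebesgue (\<Union>i. A i \<inter> {0..1}) g"
          using m by (intro si sets.countable_UN') (auto simp: sets_unit_lebesgue)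
      qed (rule m)
      also have "(\<Union>i. A i \<inter> {0..1}) = (\<Union>i. A i) \<inter> {0..1}" by auto
      finally show ?case by (simp add: cap union)
    qed
  qed
  show ?thesis
    using int by (rule density_zero) (auto simp: sets_unit_lebesgue borel_eq_atMost intro: all)
qed

lemma dyadic_dense_unit: "closure (dyadic_rationals \<inter> {0<..<1}) = {0..1}"
proof
  show "closure (dyadic_rationals \<inter> {0<..<1}) \<subseteq> {0..1}" by (rule closure_minimal) auto
  have "x \<in> closure (dyadic_rationals \<inter> {0<..<1})" if "x \<in> {0<..<1}" for x
    unfolding closure_approachable
  proof (intro allI impI)
    fix e :: real assume "e > 0"
    then have "x < min 1 (x + e)" using that by auto
    then obtain d where "d \<in> dyadic_rationals" "x < d" "d < min 1 (x + e)"
      using dyadic_rationals_between by blast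
    then show "\<exists>y\<in>dyadic_rationals \<inter> {0<..<1}. dist y x < e"
      using that by (intro bexI[of _ d]) (auto simp: dist_real_def)
  qed
  then have "closure {0<..<1} \<subseteq> closure (dyadic_rationals \<inter> {0<..<1::real})"
    by (intro closure_minimal) auto
  then show "{0..1} \<subseteq> closure (dyadic_rationals \<inter> {0<..<1::real})" by simp
qed

text \<open>The integral from 0 to y is continuous in y and takes one value at all dyadic points of
  (0, 1). By density it is constant on the closed interval, and its value at 0 is 0. The endpoints 0
  and 1 are left out of the hypothesis because the masses are computed only for intervals away from
  them.\<close>

lemma AE_zero_if_integral_dyadic_zero:
  fixes g :: "real \<Rightarrow> complex"
  assumes int: "integrable unit_lebesgue g"
    and zero: "\<And>u v. u \<in> dyadic_rationals \<Longrightarrow> v \<in> dyadic_rationals \<Longrightarrow> 0 < u \<Longrightarrow> u < v \<Longrightarrow> v < 1 \<Longrightarrow>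
      (\<integral>x. g x * indicator {u..v} x \<partial>unit_lebesgue) = 0"
  shows "AE x in unit_lebesgue. g x = 0"
proof (rule AE_zero_if_integral_atMost_zero[OF int])
  have sil: "set_integrable lborel {0..1} g"
    using int by (simp add: integrable_unit_lebesgue set_integrable_def)
  have gi: "g integrable_on {0..1}" by (rule set_borel_integral_eq_integral(1)[OF sil])
  \<comment> \<open>The gauge integral is brought in for the continuity of the indefinite integral
    and for combining adjacent intervals.\<close>
  have HK: "(\<integral>x. g x * indicator {u..v} x \<partial>unit_lebesgue) = integral {u..v} g"
    if "0 \<le> u" "v \<le> 1" for u v
  proof -
    have "set_integrable lborel {u..v} g" using sil by (rule set_integrable_subset) (use that in auto)
    then have "integral {u..v} g = (LINT x:{u..v}|lborel. g x)"
      by (simp add: set_borel_integral_eq_integral(2))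
    also have "\<dots> = (\<integral>x. g x * indicator {u..v} x \<partial>unit_lebesgue)"
      unfolding set_lebesgue_integral_def integral_unit_lebesgue using that
      by (intro Bochner_Integration.integral_cong refl) (auto simp: indicator_def)
    finally show ?thesis ..
  qed
  define F where "F y = integral {0..y} g" for y
  have cont: "continuous_on {0..1} F"
    unfolding F_def by (rule indefinite_integral_continuous_1[OF gi])
  have Fuv: "F u = F v" if "u \<in> dyadic_rationals \<inter> {0<..<1}" "v \<in> dyadic_rationals \<inter> {0<..<1}" "u < v" for u v
  proof -
    have "g integrable_on {0..v}" using gi by (rule integrable_on_subinterval) (use that in auto)
    then have "F u + integral {u..v} g = F v"
      unfolding F_def using that by (intro Henstock_Kurzweil_Integration.integral_combine) auto
    then show ?thesis using zero[of u v] HK[of u v] that by simp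
  qed
  have "1 / 2 \<in> dyadic_rationals" using dyadic_rationals_half[of 1] dyadic_rationals_of_int[of 1] by simp
  then have half: "1 / 2 \<in> dyadic_rationals \<inter> {0<..<1::real}" by simp
  have Fc: "F u = F (1 / 2)" if "u \<in> dyadic_rationals \<inter> {0<..<1}" for u
    using Fuv[OF that half] Fuv[OF half that] by (metis linorder_cases)
  have Fc': "F y = F (1 / 2)" if "y \<in> {0..1}" for y
  proof (rule continuous_constant_on_closure[where S = "dyadic_rationals \<inter> {0<..<1}" and f = F])
    show "continuous_on (closure (dyadic_rationals \<inter> {0<..<1})) F"
      using cont by (simp only: dyadic_dense_unit)
    show "y \<in> closure (dyadic_rationals \<inter> {0<..<1})" using that by (simp only: dyadic_dense_unit)
  qed (rule Fc)
  have F0: "F y = 0" if "y \<in> {0..1}" for y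
    using Fc'[of 0] Fc'[OF that] by (simp add: F_def)
  fix y :: real
  have "(LINT x:{..y}|unit_lebesgue. g x) = (\<integral>x. g x * indicator {0..min y 1} x \<partial>unit_lebesgue)"
    unfolding set_lebesgue_integral_def
    by (intro Bochner_Integration.integral_cong refl) (auto simp: indicator_def space_unit_lebesgue)
  also have "\<dots> = integral {0..min y 1} g" by (rule HK) auto
  \<comment> \<open>For negative \<open>y\<close> the interval is empty.\<close>
  also have "\<dots> = 0" using F0[of "min y 1"] by (cases "y < 0") (auto simp: F_def)
  finally show "(LINT x:{..y}|unit_lebesgue. g x) = 0" .
qed

section \<open>Fixed vectors of a contraction\<close>

text \<open>Squared moduli remove the phase, so whatever \<open>s\<close> is, a fixed vector gives a
  finite invariant measure with density |f|^2. The map pushes every point of (a, b) towards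
  \<open>a\<close>, and finiteness leaves such a measure no mass there.\<close>

lemma koopman_rep_fixed_vanishes:
  assumes ns: "nonsingular (contraction a b)" and ab: "0 \<le> a" "a < b" "b \<le> 1"
    and f: "sq_integrable f"
    and fixed: "koopman_rep s (contraction a b) (abs_l2 f) = abs_l2 f"
  shows "AE x in unit_lebesgue. x \<in> {a<..<b} \<longrightarrow> f x = 0"
proof -
  let ?\<gamma> = "contraction a b" and ?\<psi> = "expansion a b"
  have [measurable]: "f \<in> borel_measurable unit_lebesgue" using f by (simp add: sq_integrable_def)
  have \<gamma>m: "?\<gamma> \<in> unit_lebesgue \<rightarrow>\<^sub>M unit_lebesgue" using ns by (simp add: nonsingular_def)
  have int: "integrable unit_lebesgue (\<lambda>x. indicat_real {u<..v} x * (cmod (f x))\<^sup>2)" for u v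
  proof (rule Bochner_Integration.integrable_bound)
    show "integrable unit_lebesgue (\<lambda>x. (cmod (f x))\<^sup>2)" using f by (simp add: sq_integrable_def)
    show "(\<lambda>x. indicat_real {u<..v} x * (cmod (f x))\<^sup>2) \<in> borel_measurable unit_lebesgue"
      by measurable
  qed (auto simp: indicator_def)
  have "AE x in unit_lebesgue. koopman_fun s ?\<gamma> f x = f x"
    using fixed ns f by (simp add: koopman_rep_abs_l2 abs_l2_eq_iff sq_integrable_koopman_fun)
  then have D: "AE x in unit_lebesgue. pushforward_deriv ?\<gamma> x * (cmod (f (?\<psi> x)))\<^sup>2 = (cmod (f x))\<^sup>2"
  proof eventually_elim
    case (elim x)
    have "(cmod (koopman_fun s ?\<gamma> f x))\<^sup>2 = pushforward_deriv ?\<gamma> x * (cmod (f (?\<psi> x)))\<^sup>2"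
      by (simp add: koopman_fun_def norm_mult power_mult_distrib cmod_pushforward_powr
          inv_contraction ab)
    then show ?case by (simp add: elim)
  qed
  \<comment> \<open>The measure \<open>\<bar>f\<bar>\<^sup>2\<close> is invariant; iterating \<open>?\<psi>\<close> from the midpoint in both directions
    exhausts \<open>(a, b)\<close> by intervals of mass 0.\<close>
  define N where "N u v = (\<integral>x. indicat_real {u<..v} x * (cmod (f x))\<^sup>2 \<partial>unit_lebesgue)" for u v
  have Ninv: "N (?\<psi> u) (?\<psi> v) = N u v" for u v
  proof -
    define h where "h y = indicat_real {u<..v} (?\<gamma> y) * (cmod (f y))\<^sup>2" for y
    have mono: "?\<psi> x < ?\<psi> y \<longleftrightarrow> x < y" "?\<psi> x \<le> ?\<psi> y \<longleftrightarrow> x \<le> y" for x y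
      using strict_mono_expansion[OF ab(2)] by (simp_all add: strict_mono_less strict_mono_less_eq)
    \<comment> \<open>\<open>?\<psi>\<close> is increasing and inverse to \<open>?\<gamma>\<close>,
      so the conditions on \<open>y\<close> translate into conditions on
      \<open>?\<gamma> y\<close>.\<close>
    have ind: "indicat_real {?\<psi> u<..?\<psi> v} y = indicat_real {u<..v} (?\<gamma> y)" for y
      using mono[of u "?\<gamma> y"] mono[of "?\<gamma> y" v] ab by (simp add: expansion_contraction indicator_def)
    have "(\<lambda>y. indicat_real {u<..v} (?\<gamma> y)) \<in> borel_measurable unit_lebesgue"
      by (rule measurable_compose[OF \<gamma>m]) (simp add: measurable_indicator_unit_lebesgue)
    then have hm: "h \<in> borel_measurable unit_lebesgue"
      unfolding h_def by measurable
    have "inv ?\<gamma> \<in> unit_lebesgue \<rightarrow>\<^sub>M unit_lebesgue" using ns by (simp add: nonsingular_def)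
    then have hi: "(\<lambda>x. h (inv ?\<gamma> x)) \<in> borel_measurable unit_lebesgue"
      using hm by (rule measurable_compose)
    have "N (?\<psi> u) (?\<psi> v) = (\<integral>y. h y \<partial>unit_lebesgue)" unfolding N_def ind h_def ..
    also have "\<dots> = (\<integral>x. pushforward_deriv ?\<gamma> x *\<^sub>R h (inv ?\<gamma> x) \<partial>unit_lebesgue)"
      using integrable_pushforward(2)[OF ns hm] by (rule sym)
    also have "\<dots> = N u v"
      unfolding N_def
    proof (rule integral_cong_AE)
      show "(\<lambda>x. pushforward_deriv ?\<gamma> x *\<^sub>R h (inv ?\<gamma> x)) \<in> borel_measurable unit_lebesgue"
        using hi by measurable
      show "AE x in unit_lebesgue. pushforward_deriv ?\<gamma> x *\<^sub>R h (inv ?\<gamma> x) =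
          indicat_real {u<..v} x * (cmod (f x))\<^sup>2"
        using D by eventually_elim
          (use ab in \<open>simp add: h_def inv_contraction contraction_expansion\<close>)
    qed (rule borel_measurable_integrable[OF int])
    finally show ?thesis .
  qed
  \<comment> \<open>Half-open intervals make this additivity exact at every point.\<close>
  have add: "N a u + N u v = N a v" if "a \<le> u" "u \<le> v" for u v
    unfolding N_def using that
    by (subst Bochner_Integration.integral_add[symmetric, OF int int])
      (auto simp: indicator_def intro!: Bochner_Integration.integral_cong)
  have \<psi>a: "?\<psi> a = a" using ab by (intro expansion_outside) auto
  define m where "m = (a + b) / 2"
  \<comment> \<open>The images of the midpoint under n steps of \<open>?\<gamma>\<close> and of
    \<open>?\<psi>\<close>: the expansion doubles the distance to \<open>a\<close> while that is at
    most (b - a)/4, and halves the distance to \<open>b\<close> on the right half.\<close>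
  define u v where "u n = a + (m - a) / 2 ^ n" and "v n = b - (b - m) / 2 ^ n" for n :: nat
  have am: "a < m" "m < b" using ab by (auto simp: m_def)
  have half: "d / 2 ^ n \<le> d" if "d \<ge> 0" for d :: real and n :: nat
    using divide_left_mono[of 1 "2 ^ n" d] that by simp
  have Nu: "N a (u n) = N a m" for n
  proof (induction n)
    case (Suc n)
    have "u (Suc n) \<le> (3 * a + b) / 4" "a \<le> u (Suc n)"
      using half[of "m - a" n] am by (simp_all add: u_def m_def) (simp add: field_simps)
    then have "?\<psi> (u (Suc n)) = 2 * u (Suc n) - a" by (intro expansion_left ab(2))
    also have "\<dots> = u n" by (simp add: u_def field_simps)
    finally show ?case using Ninv[of a "u (Suc n)"] Suc \<psi>a by simp
  qed (simp add: u_def)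
  have vm: "m \<le> v n" "v n \<le> b" for n
    using half[of "b - m" n] am by (auto simp: v_def)
  have Nv: "N a (v n) = N a m" for n
  proof (induction n)
    case (Suc n)
    have "?\<psi> (v n) = (v n + b) / 2" using vm[of n] by (intro expansion_right ab(2)) (simp_all add: m_def)
    also have "\<dots> = v (Suc n)" by (simp add: v_def field_simps)
    finally show ?case using Ninv[of a "v n"] Suc \<psi>a by simp
  qed (simp add: v_def)
  have "AE x in unit_lebesgue. x \<in> {u n<..v n} \<longrightarrow> f x = 0" for n
  proof -
    have "a \<le> u n" "u n \<le> m" using half[of "m - a" n] am by (auto simp: u_def)
    \<comment> \<open>Both N a (u n) and N a (v n) equal N a m; the masses are finite reals, so they
      cancel.\<close>
    then have "N (u n) (v n) = 0" using add[of "u n" "v n"] vm[of n] Nu[of n] Nv[of n] by simp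
    then have "AE x in unit_lebesgue. indicat_real {u n<..v n} x * (cmod (f x))\<^sup>2 = 0"
      using integral_nonneg_eq_0_iff_AE[OF int] by (auto simp: N_def)
    then show ?thesis by eventually_elim (auto simp: indicator_def)
  qed
  then have "AE x in unit_lebesgue. \<forall>n. x \<in> {u n<..v n} \<longrightarrow> f x = 0"
    by (intro AE_all_countable[THEN iffD2] allI)
  then show ?thesis
  proof eventually_elim
    case (elim x)
    show ?case
    proof
      assume x: "x \<in> {a<..<b}"
      let ?e = "min ((x - a) / (m - a)) ((b - x) / (b - m))"
      have "?e > 0" using x am by simp
      then obtain n where "(1 / 2) ^ n < ?e" using real_arch_pow_inv[of ?e "1/2"] by auto
      then have "1 / 2 ^ n < (x - a) / (m - a)" "1 / 2 ^ n < (b - x) / (b - m)"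
        by (auto simp: power_one_over)
      then have "(m - a) / 2 ^ n < x - a" "(b - m) / 2 ^ n < b - x"
        using am by (simp_all add: pos_less_divide_eq)
      then have "x \<in> {u n<..v n}" by (auto simp: u_def v_def)
      then show "f x = 0" using elim by blast
    qed
  qed
qed

section \<open>Intertwining operators\<close>

lemma AE_unit_lebesgue_notin_finite:
  assumes "finite C" shows "AE x in unit_lebesgue. x \<notin> C"
proof -
  have "C \<inter> {0..1} \<in> null_sets unit_lebesgue"
    using assms by (simp add: null_sets_unit_lebesgue negligible_finite finite_imp_closed borel_closed)
  then have "AE x in unit_lebesgue. x \<notin> C \<inter> {0..1}" by (rule AE_not_in)
  moreover have "AE x in unit_lebesgue. x \<in> {0..1}"
    using AE_space[of unit_lebesgue] by (simp add: space_unit_lebesgue)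
  ultimately show ?thesis by eventually_elim auto
qed

lemma of_real_powr_eq_exp: "p > 0 \<Longrightarrow> complex_of_real p powr z = exp (z * complex_of_real (ln p))"
  by (simp add: powr_def Ln_of_real)

lemma thompson_F_affine_slope:
  assumes \<gamma>: "\<gamma> \<in> thompson_F" and pq: "0 \<le> p" "p < q" "q \<le> 1"
    and aff: "\<And>x. x \<in> {p..q} \<Longrightarrow> \<gamma> x = m * x + c"
  shows "\<exists>k::int. m = 2 powi k"
proof -
  have "((\<lambda>x. m * x + c) has_real_derivative m) (at ((p + q) / 2))"
    by (auto intro!: derivative_eq_intros)
  then have "(\<gamma> has_real_derivative m) (at ((p + q) / 2))"
    by (rule has_field_derivative_transform_within_open[where S = "{p<..<q}"]) (use pq aff in auto)
  then have "(\<gamma> has_real_derivative m) (at ((p + q) / 2) within {0..1})"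
    by (rule has_field_derivative_at_within)
  moreover have "(p + q) / 2 \<in> {0..1}" using pq by auto
  ultimately show ?thesis using \<gamma> unfolding thompson_F_def by blast
qed

text \<open>Up to the finitely many images of break points and of 0 and 1, the unit interval is
  covered by images of affine pieces with rational ends. There are countably many of these, so the
  exceptional null sets of the single pieces can be united.\<close>

lemma pushforward_deriv_power_of_two:
  assumes \<gamma>: "\<gamma> \<in> thompson_F"
  shows "AE x in unit_lebesgue. \<exists>k::int. pushforward_deriv \<gamma> x = 2 powi k"
proof -
  have ns: "nonsingular \<gamma>" using \<gamma> by (rule thompson_F_nonsingular)
  have "piecewise_linear_on {0..1} \<gamma>" using \<gamma> by (simp add: thompson_F_def)
  then obtain B where B: "finite B" and lin: "\<And>a b. a < b \<Longrightarrow> {a..b} \<subseteq> {0..1} \<Longrightarrow> {a<..<b} \<inter> B = {} \<Longrightarrow>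
        \<exists>m c. \<forall>x\<in>{a..b}. \<gamma> x = m * x + c"
    unfolding piecewise_linear_on_def by blast
  define gap where "gap p q \<longleftrightarrow> 0 \<le> p \<and> p < q \<and> q \<le> 1 \<and> {p<..<q} \<inter> B = {}" for p q :: real
  have piece: "AE x in unit_lebesgue. gap p q \<longrightarrow> x \<in> \<gamma> ` {p..q} \<longrightarrow>
      (\<exists>k::int. pushforward_deriv \<gamma> x = 2 powi k)" for p q
  proof (cases "gap p q")
    case True
    then have pq: "0 \<le> p" "p < q" "q \<le> 1" and "{p<..<q} \<inter> B = {}" by (auto simp: gap_def)
    moreover have "{p..q} \<subseteq> {0..1}" using pq by auto
    ultimately obtain m c where "\<forall>x\<in>{p..q}. \<gamma> x = m * x + c"
      using lin[of p q] by blast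
    then have aff: "\<And>x. x \<in> {p..q} \<Longrightarrow> \<gamma> x = m * x + c" by (rule bspec)
    have "\<exists>k::int. m = 2 powi k"
      by (rule thompson_F_affine_slope[OF \<gamma> pq]) (rule aff)
    then obtain k :: int where k: "m = 2 powi k" ..
    have m: "m > 0" unfolding k by simp
    have "AE x in unit_lebesgue. x \<in> {m * p + c..m * q + c} \<longrightarrow> pushforward_deriv \<gamma> x = 1 / m"
      by (rule pushforward_deriv_affine[OF ns _ pq(1,3) m]) (rule aff)
    moreover have "\<gamma> ` {p..q} \<subseteq> {m * p + c..m * q + c}" using aff m by auto
    moreover have m': "1 / m = 2 powi (- k)" unfolding k by (simp add: power_int_minus_divide)
    ultimately show ?thesis by (elim eventually_mono) (metis subsetD m')
  qed simp
  have "AE x in unit_lebesgue. \<forall>p\<in>\<rat>. \<forall>q\<in>\<rat>. gap p q \<longrightarrow> x \<in> \<gamma> ` {p..q} \<longrightarrow>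
      (\<exists>k::int. pushforward_deriv \<gamma> x = 2 powi k)"
    by (intro AE_ball_countable[THEN iffD2] ballI countable_rat piece)
  moreover have "AE x in unit_lebesgue. x \<notin> \<gamma> ` (B \<union> {0, 1})"
    using B by (intro AE_unit_lebesgue_notin_finite) simp
  moreover have "AE x in unit_lebesgue. x \<in> space unit_lebesgue" by (rule AE_space)
  ultimately show ?thesis
  proof eventually_elim
    case (elim x)
    define y where "y = inv \<gamma> x"
    have x: "x = \<gamma> y" using ns by (simp add: y_def nonsingular_def bij_is_surj surj_f_inv_f)
    have "inv \<gamma> \<in> unit_lebesgue \<rightarrow>\<^sub>M unit_lebesgue" using ns by (simp add: nonsingular_def)
    from measurable_space[OF this elim(3)] have "y \<in> {0..1}"
      by (simp add: y_def space_unit_lebesgue)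
    moreover have "y \<notin> B \<union> {0, 1}" using elim(2) x by blast
    then have yB: "y \<notin> B" "y \<noteq> 0" "y \<noteq> 1" by simp_all
    ultimately have y: "0 < y" "y < 1" by auto
    obtain r where r: "y < r" "r \<le> 1" "{y<..<r} \<inter> B = {}" using finite_gap_right[OF B y(2)] by blast
    obtain l where l: "l < y" "0 \<le> l" "{l<..<y} \<inter> B = {}" using finite_gap_left[OF B y(1)] by blast
    obtain p where p: "p \<in> \<rat>" "l < p" "p < y" using Rats_dense_in_real[OF l(1)] by blast
    obtain q where q: "q \<in> \<rat>" "y < q" "q < r" using Rats_dense_in_real[OF r(1)] by blast
    have "{p<..<q} \<subseteq> {l<..<y} \<union> {y} \<union> {y<..<r}" using p q by auto
    then have "{p<..<q} \<inter> B = {}" using r(3) l(3) yB(1) by blast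
    moreover have "0 \<le> p" "p < q" "q \<le> 1" using p q l(2) r(2) by simp_all
    ultimately have "gap p q" unfolding gap_def by blast
    moreover have "x \<in> \<gamma> ` {p..q}" unfolding x using p q by (intro imageI) simp
    ultimately show ?case using elim(1) p(1) q(1) by blast
  qed
qed

lemma koopman_rep_periodic:
  assumes k: "s - t = 2 * of_int k * pi / ln 2" and \<gamma>: "\<gamma> \<in> thompson_F"
  shows "koopman_rep s \<gamma> = koopman_rep t \<gamma>"
proof
  fix \<xi>
  obtain f where f: "sq_integrable f" "\<xi> = abs_l2 f" by (rule l2_cases)
  have ns: "nonsingular \<gamma>" using \<gamma> by (rule thompson_F_nonsingular)
  have eq: "complex_of_real (2 powi j) powr Complex (1/2) s = complex_of_real (2 powi j) powr Complex (1/2) t" for j :: int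
  proof -
    have "s * ln 2 = t * ln 2 + 2 * of_int k * pi" using k by (simp add: field_simps)
    moreover have "ln (2 powi j) = of_int j * ln (2::real)"
      by (simp add: powr_real_of_int'[symmetric] ln_powr)
    \<comment> \<open>For the derivative value 2^j the two exponents differ by 2 pi i j k, which the
      exponential does not see.\<close>
    ultimately have "Complex (1/2) s * complex_of_real (ln (2 powi j)) =
        Complex (1/2) t * complex_of_real (ln (2 powi j)) + 2 * of_int (j * k) * pi * \<i>"
      by (simp add: complex_eq_iff algebra_simps)
    also have "exp \<dots> = exp (Complex (1/2) t * complex_of_real (ln (2 powi j)))"
      unfolding exp_eq by (intro exI[of _ "j * k"]) simp
    finally show ?thesis by (simp add: of_real_powr_eq_exp del: of_real_power_int)
  qed
  have "AE x in unit_lebesgue. koopman_fun s \<gamma> f x = koopman_fun t \<gamma> f x"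
    using pushforward_deriv_power_of_two[OF \<gamma>]
    by eventually_elim (use eq in \<open>auto simp: koopman_fun_def simp del: of_real_power_int\<close>)
  then show "koopman_rep s \<gamma> \<xi> = koopman_rep t \<gamma> \<xi>"
    using f ns by (simp add: koopman_rep_abs_l2 abs_l2_eq_iff sq_integrable_koopman_fun)
qed

section \<open>Inner products with indicator vectors\<close>

lemma unitary_l2_id: "unitary_l2 id"
proof -
  interpret vector_space scale_l2 by (rule vector_space_scale_l2)
  show ?thesis unfolding unitary_l2_def using linear_id by (auto simp: id_def)
qed

definition indicator_l2 :: "real set \<Rightarrow> l2"
  where "indicator_l2 A = abs_l2 (indicator A)"

lemma inner_indicator_l2:
  assumes "sq_integrable f" "A \<in> sets borel"
  shows "inner_l2 (abs_l2 f) (indicator_l2 A) = (\<integral>x. f x * indicator A x \<partial>unit_lebesgue)"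
proof -
  have "cnj (indicator A x) = indicator A x" for x :: real by (simp add: indicator_def)
  then show ?thesis using assms by (simp add: indicator_l2_def inner_abs_l2 sq_integrable_indicator)
qed

lemma integrable_times_indicator:
  assumes "sq_integrable f" "A \<in> sets borel"
  shows "integrable unit_lebesgue (\<lambda>x. f x * indicator A x)"
proof (rule Bochner_Integration.integrable_bound[OF sq_integrable_integrable[OF assms(1)]])
  show "(\<lambda>x. f x * indicator A x) \<in> borel_measurable unit_lebesgue"
    using assms by (intro borel_measurable_times measurable_indicator_unit_lebesgue)
      (simp_all add: sq_integrable_def)
qed (auto simp: indicator_def)

lemma inner_add_indicator_l2:
  assumes "A \<in> sets borel"
  shows "inner_l2 (\<xi> + \<eta>) (indicator_l2 A) = inner_l2 \<xi> (indicator_l2 A) + inner_l2 \<eta> (indicator_l2 A)"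
proof -
  obtain f where f: "sq_integrable f" "\<xi> = abs_l2 f" by (rule l2_cases)
  obtain g where g: "sq_integrable g" "\<eta> = abs_l2 g" by (rule l2_cases)
  show ?thesis using f g assms
    by (simp add: plus_abs_l2 inner_indicator_l2 sq_integrable_add distrib_right integrable_times_indicator)
qed

lemma inner_scale_l2: "inner_l2 (scale_l2 c \<xi>) (scale_l2 d \<eta>) = c * cnj d * inner_l2 \<xi> \<eta>"
proof -
  obtain f where f: "sq_integrable f" "\<xi> = abs_l2 f" by (rule l2_cases)
  obtain g where g: "sq_integrable g" "\<eta> = abs_l2 g" by (rule l2_cases)
  have "(c * f x) * cnj (d * g x) = (c * cnj d) * (f x * cnj (g x))" for x by simp
  then show ?thesis using f g
    by (simp only: scale_abs_l2 inner_abs_l2 sq_integrable_scale Bochner_Integration.integral_mult_right_zero)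
qed

lemma indicator_l2_Un:
  assumes "A \<in> sets borel" "B \<in> sets borel" "A \<inter> B = {}"
  shows "indicator_l2 (A \<union> B) = indicator_l2 A + indicator_l2 B"
proof -
  have "(indicator (A \<union> B) :: real \<Rightarrow> complex) = (\<lambda>x. indicator A x + indicator B x)"
    using assms(3) by (auto simp: fun_eq_iff indicator_def)
  then show ?thesis using assms by (simp add: indicator_l2_def plus_abs_l2 sq_integrable_indicator)
qed

section \<open>Locality and mass of an intertwining operator\<close>

context
  fixes s t :: real and U :: "l2 \<Rightarrow> l2"
  assumes unitary: "unitary_l2 U"
    and intertwine: "\<And>\<gamma> \<xi>. \<gamma> \<in> thompson_F \<Longrightarrow> U (koopman_rep s \<gamma> \<xi>) = koopman_rep t \<gamma> (U \<xi>)"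
begin

lemma U_add: "U (\<xi> + \<eta>) = U \<xi> + U \<eta>" and U_scale: "U (scale_l2 c \<xi>) = scale_l2 c (U \<xi>)"
proof -
  have "Vector_Spaces.linear scale_l2 scale_l2 U" using unitary by (simp add: unitary_l2_def)
  then interpret Vector_Spaces.linear scale_l2 scale_l2 U .
  show "U (\<xi> + \<eta>) = U \<xi> + U \<eta>" "U (scale_l2 c \<xi>) = scale_l2 c (U \<xi>)"
    by (rule add, rule scale)
qed

text \<open>The indicator of \<open>A\<close> is fixed by the contraction under the first
  representation, so its image under \<open>U\<close> is fixed under the second and vanishes on (a,
  b).\<close>

lemma intertwiner_local:
  assumes ab: "a \<in> dyadic_rationals" "b \<in> dyadic_rationals" "0 \<le> a" "a < b" "b \<le> 1"
    and A: "A \<in> sets borel" "A \<inter> {a<..<b} = {}"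
  shows "inner_l2 (U (indicator_l2 A)) (indicator_l2 {a..b}) = 0"
proof -
  let ?\<gamma> = "contraction a b"
  have F: "?\<gamma> \<in> thompson_F" using ab by (rule contraction_in_thompson_F)
  have ns: "nonsingular ?\<gamma>" using F by (rule thompson_F_nonsingular)
  obtain f where f: "sq_integrable f" "U (indicator_l2 A) = abs_l2 f" by (rule l2_cases)
  have "koopman_rep s ?\<gamma> (indicator_l2 A) = indicator_l2 A"
    unfolding indicator_l2_def by (rule koopman_rep_indicator_fixed[OF ns ab(3-5) A])
  then have "koopman_rep t ?\<gamma> (abs_l2 f) = abs_l2 f"
    using intertwine[OF F, of "indicator_l2 A"] f(2) by simp
  then have "AE x in unit_lebesgue. x \<in> {a<..<b} \<longrightarrow> f x = 0"
    by (rule koopman_rep_fixed_vanishes[OF ns ab(3-5) f(1)])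
  moreover have "AE x in unit_lebesgue. x \<notin> {a, b}" by (rule AE_unit_lebesgue_notin_finite) simp
  ultimately have "AE x in unit_lebesgue. f x * indicator {a..b} x = 0"
    by eventually_elim (auto simp: indicator_def)
  then show ?thesis using f by (simp add: inner_indicator_l2 integral_eq_zero_AE)
qed

text \<open>The complex measure with density \<open>U 1\<close>, on closed intervals;
  \<open>UNIV\<close> stands for the unit interval. This form is visibly additive, while the form in
  \<open>mass_eq_diagonal\<close> is the one that transforms under the group.\<close>

definition mass :: "real \<Rightarrow> real \<Rightarrow> complex"
  where "mass u v = inner_l2 (U (indicator_l2 UNIV)) (indicator_l2 {u..v})"

text \<open>Split 1 into the indicators of the interval and of its complement: locality kills the
  contribution of the complement.\<close>

lemma mass_eq_diagonal:
  assumes ab: "a \<in> dyadic_rationals" "b \<in> dyadic_rationals" "0 \<le> a" "a < b" "b \<le> 1"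
  shows "mass a b = inner_l2 (U (indicator_l2 {a..b})) (indicator_l2 {a..b})"
proof -
  have "indicator_l2 UNIV = indicator_l2 {a..b} + indicator_l2 (- {a..b})"
    using indicator_l2_Un[of "{a..b}" "- {a..b}"] by simp
  moreover have "inner_l2 (U (indicator_l2 (- {a..b}))) (indicator_l2 {a..b}) = 0"
    using ab by (rule intertwiner_local) auto
  ultimately show ?thesis by (simp add: mass_def U_add inner_add_indicator_l2)
qed

lemma mass_split: "u \<le> v \<Longrightarrow> v \<le> w \<Longrightarrow> mass u w = mass u v + mass v w"
proof -
  assume uvw: "u \<le> v" "v \<le> w"
  obtain f where f: "sq_integrable f" "U (indicator_l2 UNIV) = abs_l2 f" by (rule l2_cases)
  have i: "integrable unit_lebesgue (\<lambda>x. f x * indicator {p..q} x)" for p q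
    using f(1) by (rule integrable_times_indicator) simp
  \<comment> \<open>The two closed intervals overlap in \<open>v\<close>, which is a null
    set.\<close>
  have "AE x in unit_lebesgue. x \<notin> {v}" by (rule AE_unit_lebesgue_notin_finite) simp
  then have "AE x in unit_lebesgue. f x * indicator {u..w} x =
      f x * indicator {u..v} x + f x * indicator {v..w} x"
    by eventually_elim (use uvw in \<open>auto simp: indicator_def\<close>)
  then have "(\<integral>x. f x * indicator {u..w} x \<partial>unit_lebesgue) =
      (\<integral>x. f x * indicator {u..v} x + f x * indicator {v..w} x \<partial>unit_lebesgue)"
    by (intro integral_cong_AE borel_measurable_integrable[OF i]
        borel_measurable_integrable[OF Bochner_Integration.integrable_add[OF i i]])
  then show ?thesis by (simp add: mass_def f inner_indicator_l2 i)
qed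

text \<open>Apply the unitary \<open>koopman_rep t \<gamma>\<close> to both arguments of the inner
  product and move it through \<open>U\<close>, where it becomes
  \<open>koopman_rep s \<gamma>\<close>. Each argument then contributes its scalar, the second one
  conjugated.\<close>

lemma diagonal_covariant:
  assumes \<gamma>: "\<gamma> \<in> thompson_F" and aff: "\<And>x. x \<in> {p..q} \<Longrightarrow> \<gamma> x = m * x + c"
    and pq: "0 \<le> p" "q \<le> 1" and m: "m > 0"
  shows "inner_l2 (U (indicator_l2 {p..q})) (indicator_l2 {p..q}) =
    complex_of_real (1 / m) powr Complex (1/2) s * cnj (complex_of_real (1 / m) powr Complex (1/2) t) *
      inner_l2 (U (indicator_l2 {m * p + c..m * q + c})) (indicator_l2 {m * p + c..m * q + c})"
proof -
  have ns: "nonsingular \<gamma>" using \<gamma> by (rule thompson_F_nonsingular)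
  have k: "koopman_rep r \<gamma> (indicator_l2 {p..q}) =
      scale_l2 (complex_of_real (1 / m) powr Complex (1/2) r) (indicator_l2 {m * p + c..m * q + c})" for r
    unfolding indicator_l2_def by (rule koopman_rep_indicator_affine[OF ns _ pq m]) (rule aff)
  have "inner_l2 (U (indicator_l2 {p..q})) (indicator_l2 {p..q}) =
      inner_l2 (U (koopman_rep s \<gamma> (indicator_l2 {p..q}))) (koopman_rep t \<gamma> (indicator_l2 {p..q}))"
    using intertwine[OF \<gamma>] inner_koopman_rep[OF ns] by simp
  then show ?thesis by (simp only: k U_scale inner_scale_l2)
qed

text \<open>The contraction on [a - l, a + 3l] has its slope 1 piece exactly on [a + l, a + 2l] and
  moves it left by \<open>l\<close>. Slope 1 gives the factor 1.\<close>

lemma mass_translate: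
  assumes "a \<in> dyadic_rationals" "l \<in> dyadic_rationals" "0 < l" "l \<le> a" "a + 3 * l \<le> 1"
  shows "mass (a + l) (a + 2 * l) = mass a (a + l)"
proof -
  have d: "a - l \<in> dyadic_rationals" "a + 3 * l \<in> dyadic_rationals" "a + l \<in> dyadic_rationals"
      "a + 2 * l \<in> dyadic_rationals"
    using assms dyadic_rationals_of_nat_mult[of l 3] by (auto intro: dyadic_intros)
  have "contraction (a - l) (a + 3 * l) \<in> thompson_F"
    using assms d by (intro contraction_in_thompson_F) auto
  moreover have "contraction (a - l) (a + 3 * l) x = 1 * x + - l" if "x \<in> {a + l..a + 2 * l}" for x
    using contraction_middle[of "a - l" "a + 3 * l" x] that assms by (simp add: field_simps)
  ultimately show ?thesis
    using diagonal_covariant[of "contraction (a - l) (a + 3 * l)" "a + l" "a + 2 * l" 1 "- l"] assms d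
    by (simp add: mass_eq_diagonal add.commute[of l a])
qed

text \<open>The slope 1/2 piece of the contraction on [a, a + 4l] is [a, a + 2l]. With 1/m = 2, the
  exponents 1/2 + is and 1/2 - it add up to 1 + i(s - t), which gives the factor.\<close>

lemma mass_halve:
  assumes "a \<in> dyadic_rationals" "l \<in> dyadic_rationals" "0 < l" "0 \<le> a" "a + 4 * l \<le> 1"
  shows "mass a (a + 2 * l) = 2 * exp (\<i> * complex_of_real ((s - t) * ln 2)) * mass a (a + l)"
proof -
  have d: "a + 4 * l \<in> dyadic_rationals" "a + l \<in> dyadic_rationals" "a + 2 * l \<in> dyadic_rationals"
    using assms dyadic_rationals_of_nat_mult[of l 4] by (auto intro: dyadic_intros)
  have F: "contraction a (a + 4 * l) \<in> thompson_F"
    using assms d by (intro contraction_in_thompson_F) auto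
  have aff: "contraction a (a + 4 * l) x = 1/2 * x + a / 2" if "x \<in> {a..a + 2 * l}" for x
    using contraction_left[of a "a + 4 * l" x] that assms by (simp add: field_simps)
  have "(2::complex) powr Complex (1/2) s * cnj (2 powr Complex (1/2) t) =
      exp (complex_of_real (ln 2) + \<i> * complex_of_real ((s - t) * ln 2))"
  proof -
    have p: "(2::complex) powr z = exp (z * complex_of_real (ln 2))" for z
      using of_real_powr_eq_exp[of 2 z] by simp
    show ?thesis unfolding p exp_cnj exp_add[symmetric]
      by (rule arg_cong[where f = exp]) (simp add: complex_eq_iff algebra_simps)
  qed
  also have "\<dots> = 2 * exp (\<i> * complex_of_real ((s - t) * ln 2))"
    by (simp add: exp_add exp_of_real del: of_real_mult of_real_diff)
  finally have w: "(2::complex) powr Complex (1/2) s * cnj (2 powr Complex (1/2) t) =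
      2 * exp (\<i> * complex_of_real ((s - t) * ln 2))" .
  have e: "1/2 * a + a/2 = a" "1/2 * (a + 2 * l) + a/2 = a + l" "complex_of_real (1 / (1/2)) = 2"
    by (simp_all add: field_simps)
  have "inner_l2 (U (indicator_l2 {a..a + 2 * l})) (indicator_l2 {a..a + 2 * l}) =
      2 * exp (\<i> * complex_of_real ((s - t) * ln 2)) *
        inner_l2 (U (indicator_l2 {a..a + l})) (indicator_l2 {a..a + l})"
    using diagonal_covariant[OF F aff, of a "a + 2 * l"] assms unfolding e w by simp
  then show ?thesis using assms d by (simp add: mass_eq_diagonal)
qed

lemma intertwiner_phase: "exp (\<i> * complex_of_real ((s - t) * ln 2)) = 1"
proof (rule ccontr)
  assume \<omega>: "\<not> ?thesis"
  \<comment> \<open>Additivity and translation give the factor 2, halving gives 2 times the phase;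
    if the phase is not 1, the mass must be 0. The condition \<open>l \<le> a\<close> is for the
    translation, \<open>a + 4 * l \<le> 1\<close> for the halving.\<close>
  have small: "mass a (a + l) = 0"
    if "a \<in> dyadic_rationals" "l \<in> dyadic_rationals" "0 < l" "l \<le> a" "a + 4 * l \<le> 1" for a l
  proof -
    have "mass a (a + 2 * l) = 2 * mass a (a + l)"
      using mass_split[of a "a + l" "a + 2 * l"] mass_translate[of a l] that by simp
    moreover have "mass a (a + 2 * l) = 2 * exp (\<i> * complex_of_real ((s - t) * ln 2)) * mass a (a + l)"
      using that by (intro mass_halve) auto
    ultimately show ?thesis using \<omega> by simp
  qed
  have zero: "mass u v = 0"
    if uv: "u \<in> dyadic_rationals" "v \<in> dyadic_rationals" "0 < u" "u < v" "v < 1" for u v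
  proof -
    \<comment> \<open>The interval is cut into 2^n pieces of length \<open>l\<close>. The first
      bound gives l < u, hence room on the left of every piece; the second gives v + 3l < 1, the
      right-hand condition of \<open>small\<close> for the last piece, which starts at v -
      l.\<close>
    let ?e = "min (u / (v - u)) ((1 - v) / (3 * (v - u)))"
    have "?e > 0" using uv by simp
    then obtain n where "(1/2) ^ n < ?e" using real_arch_pow_inv[of ?e "1/2"] by auto
    then have "1 / 2 ^ n < u / (v - u)" "1 / 2 ^ n < (1 - v) / (3 * (v - u))"
      by (auto simp: power_one_over)
    moreover define l where "l = (v - u) / 2 ^ n"
    ultimately have l: "l < u" "3 * l < 1 - v" using uv by (simp_all add: pos_less_divide_eq)
    have l0: "l > 0" using uv by (simp add: l_def)
    have ld: "l \<in> dyadic_rationals"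
      unfolding l_def using uv by (intro dyadic_rationals_divide_power dyadic_rationals_diff)
    have v: "v = u + of_nat (2 ^ n) * l" by (simp add: l_def)
    \<comment> \<open>The first j + 1 pieces together; the instance j = 2^n - 1 reaches
      \<open>v\<close>.\<close>
    have "mass u (u + of_nat (Suc j) * l) = 0" if "j < 2 ^ n" for j
      using that
    proof (induction j)
      case 0
      have "1 \<le> (2::real) ^ n" by simp
      then have "l * 1 \<le> l * 2 ^ n" using l0 by (intro mult_left_mono) auto
      then have "u + l \<le> v" by (simp add: v mult.commute)
      then show ?case using small[of u l] uv l l0 ld by simp
    next
      case (Suc j)
      have "of_nat (Suc (Suc j)) \<le> (of_nat (2 ^ n) :: real)" using Suc.prems by (intro of_nat_mono) simp
      then have "of_nat (Suc (Suc j)) * l \<le> of_nat (2 ^ n) * l" using l0 by (intro mult_right_mono) auto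
      then have "u + of_nat (Suc j) * l + l \<le> v" unfolding v by (simp add: algebra_simps)
      moreover have nonneg: "of_nat (Suc j) * l \<ge> 0" using l0 by simp
      moreover have "l \<le> u + of_nat (Suc j) * l" using l(1) nonneg by linarith
      ultimately have "mass (u + of_nat (Suc j) * l) (u + of_nat (Suc j) * l + l) = 0"
        using l l0 ld uv by (intro small dyadic_rationals_add dyadic_rationals_of_nat_mult) auto
      moreover have "mass u (u + of_nat (Suc j) * l + l) =
          mass u (u + of_nat (Suc j) * l) + mass (u + of_nat (Suc j) * l) (u + of_nat (Suc j) * l + l)"
        using l0 by (intro mass_split) auto
      moreover have "u + of_nat (Suc (Suc j)) * l = u + of_nat (Suc j) * l + l"
        by (simp add: algebra_simps)
      moreover have "mass u (u + of_nat (Suc j) * l) = 0" using Suc by simp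
      ultimately show ?case by (metis add_0)
    qed
    from this[of "2 ^ n - 1"] show ?thesis by (simp add: v)
  qed
  obtain f where f: "sq_integrable f" "U (indicator_l2 UNIV) = abs_l2 f" by (rule l2_cases)
  have "AE x in unit_lebesgue. f x = 0"
  proof (rule AE_zero_if_integral_dyadic_zero[OF sq_integrable_integrable[OF f(1)]])
    show "(\<integral>x. f x * indicator {u..v} x \<partial>unit_lebesgue) = 0"
      if "u \<in> dyadic_rationals" "v \<in> dyadic_rationals" "0 < u" "u < v" "v < 1" for u v
      using zero[OF that] f by (simp add: mass_def inner_indicator_l2)
  qed
  then have "AE x in unit_lebesgue. f x * cnj (f x) = 0" by eventually_elim simp
  then have "inner_l2 (U (indicator_l2 UNIV)) (U (indicator_l2 UNIV)) = 0"
    using f by (simp add: inner_abs_l2 integral_eq_zero_AE)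
  moreover have "inner_l2 (U (indicator_l2 UNIV)) (U (indicator_l2 UNIV)) =
      inner_l2 (indicator_l2 UNIV) (indicator_l2 UNIV)"
    using unitary by (simp add: unitary_l2_def)
  \<comment> \<open>The constant 1 has norm 1 and \<open>U\<close> preserves inner products, against
    \<open>U 1 = 0\<close>.\<close>
  moreover have "inner_l2 (indicator_l2 UNIV) (indicator_l2 UNIV) = 1"
  proof -
    have "measure unit_lebesgue (space unit_lebesgue) = 1"
      by (simp add: unit_lebesgue_def measure_restrict_space space_restrict_space)
    then have "(\<integral>x. indicator UNIV x * indicator UNIV x \<partial>unit_lebesgue) = (1::complex)" by simp
    moreover have "inner_l2 (abs_l2 (indicator UNIV)) (indicator_l2 UNIV) =
        (\<integral>x. indicator UNIV x * indicator UNIV x \<partial>unit_lebesgue)"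
      by (rule inner_indicator_l2) (rule sq_integrable_indicator, simp_all)
    ultimately show ?thesis unfolding indicator_l2_def[of UNIV] by metis
  qed
  ultimately show False by simp
qed

end

theorem proposition6:
  fixes s t :: real
  shows "unitarily_equivalent_on thompson_F (koopman_rep s) (koopman_rep t) \<longleftrightarrow>
    (\<exists>k::int. s - t = 2 * of_int k * pi / ln 2)"
proof
  assume "unitarily_equivalent_on thompson_F (koopman_rep s) (koopman_rep t)"
  then obtain U where U: "unitary_l2 U"
    and c: "\<And>\<gamma>. \<gamma> \<in> thompson_F \<Longrightarrow> U \<circ> koopman_rep s \<gamma> = koopman_rep t \<gamma> \<circ> U"
    by (auto simp: unitarily_equivalent_on_def)
  have "U (koopman_rep s \<gamma> \<xi>) = koopman_rep t \<gamma> (U \<xi>)" if "\<gamma> \<in> thompson_F" for \<gamma> \<xi>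
    using c[OF that] by (simp add: fun_eq_iff)
  then have "exp (\<i> * complex_of_real ((s - t) * ln 2)) = 1" using U by (intro intertwiner_phase)
  then obtain k :: int where "(s - t) * ln 2 = of_int (2 * k) * pi" by (auto simp: exp_eq_1)
  then have "s - t = 2 * of_int k * pi / ln 2" by (simp add: field_simps)
  then show "\<exists>k::int. s - t = 2 * of_int k * pi / ln 2" ..
next
  assume "\<exists>k::int. s - t = 2 * of_int k * pi / ln 2"
  then obtain k :: int where "s - t = 2 * of_int k * pi / ln 2" ..
  \<comment> \<open>The operators coincide, so the identity intertwines them.\<close>
  then have "\<And>\<gamma>. \<gamma> \<in> thompson_F \<Longrightarrow> koopman_rep s \<gamma> = koopman_rep t \<gamma>"
    by (rule koopman_rep_periodic)
  then show "unitarily_equivalent_on thompson_F (koopman_rep s) (koopman_rep t)"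
    unfolding unitarily_equivalent_on_def by (intro exI[of _ id]) (simp add: unitary_l2_id)
qed

end
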